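(* Suppose that $\max\{|\alpha q|,|vxtq|,|xztq|\}<1$. Then $$\sum_{n=0}^\infty\psi_n^{(\alpha)}(x|q)\,\Psi_n^{(\mathbf a,\mathbf b)}(u,v,z|q)\,\frac{(-1)^nq^{\binom{n+1}{2}}\,t^n}{(q;q)_n}$$ $$=\frac{(q/x,uxtq;q)_\infty}{(\alpha q,vxtq;q)_\infty}\sum_{n=0}^\infty\frac{(-1)^nq^{\binom n2}\,(1/(\alpha x),1/(uxt);q)_n}{(q/x,1/(vxt),q;q)_n}\left(\frac{\alpha uq}{v}\right)^n{}_r\Phi_s\left[\begin{matrix}a_1,\dots,a_r\\ b_1,\dots,b_s\end{matrix};q;xztq^{1-n}\right].$$
   Context: Throughout $q\in\mathbb{C}$ with $0<|q|<1$; the other letters denote complex numbers. $(a;q)_0=1$, $(a;q)_n=\prod_{i=0}^{n-1}(1-aq^i)$, $(a;q)_\infty=\prod_{i=0}^\infty(1-aq^i)$, and $(c_1,\dots,c_m;q)_n=(c_1;q)_n\cdots(c_m;q)_n$ (also for $n=\infty$). The $q$-binomial coefficient is $\begin{bmatrix}n\\k\end{bmatrix}_q=\frac{(q;q)_n}{(q;q)_k(q;q)_{n-k}}$. Let $r,s$ be non-negative integers, $\mathbf a=(a_1,\dots,a_r)$, $\mathbf b=(b_1,\dots,b_s)$, and $W_k(\mathbf a,\mathbf b)=\frac{(a_1,\dots,a_r;q)_k}{(b_1,\dots,b_s;q)_k}$. The basic hypergeometric series is $${}_r\Phi_s\left[\begin{matrix}a_1,\dots,a_r\\ b_1,\dots,b_s\end{matrix};q;z\right]=\sum_{k=0}^\infty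 W_k(\mathbf a,\mathbf b)\left[(-1)^kq^{\binom k2}\right]^{1+s-r}\frac{z^k}{(q;q)_k}.$$ Cauchy polynomials: $P_n(x,y)=(x-y)(x-qy)\cdots(x-q^{n-1}y)$, $P_0=1$. Generalized $q$-hypergeometric polynomials: $$\Psi_n^{(\mathbf a,\mathbf b)}(x,y,z|q)=(-1)^nq^{-\binom n2}\sum_{k=0}^n\begin{bmatrix}n\\k\end{bmatrix}_q\left[(-1)^kq^{\binom k2}\right]^{1+s-r}W_k(\mathbf a,\mathbf b)\,P_{n-k}(y,x)\,z^k.$$ Al-Salam-Carlitz (Hahn) polynomials: $$\psi_n^{(\alpha)}(x|q)=\sum_{k=0}^n\begin{bmatrix}n\\k\end{bmatrix}_qq^{k(k-n)}(\alpha q^{1-k};q)_k\,x^k.$$ Parameters are understood to be such that no denominator vanishes and the ${}_r\Phi_s$ series occurring converge.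
   Formalization: The identity is false as printed (e.g. r=s=0, z=0, α=1, q=1/2, x=v=-1, u=-3/10, t near 1/4); it is proved assuming also that the double series obtained by inserting the series expansion of ψ_m into the left side converges absolutely. *)

theory Defs
  imports "HOL-Analysis.Analysis"
begin

definition qpoch :: "complex \<Rightarrow> complex \<Rightarrow> nat \<Rightarrow> complex" where
  "qpoch a q n = (\<Prod>i<n. 1 - a * q ^ i)"

definition qpoch_inf :: "complex \<Rightarrow> complex \<Rightarrow> complex" where
  "qpoch_inf a q = (\<Prod>i. 1 - a * q ^ i)"

definition qpochs :: "complex list \<Rightarrow> complex \<Rightarrow> nat \<Rightarrow> complex" where
  "qpochs cs q n = (\<Prod>c\<leftarrow>cs. qpoch c q n)"

definition qpochs_inf :: "complex list \<Rightarrow> complex \<Rightarrow> complex" where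
  "qpochs_inf cs q = (\<Prod>c\<leftarrow>cs. qpoch_inf c q)"

definition qbinom :: "complex \<Rightarrow> nat \<Rightarrow> nat \<Rightarrow> complex" where
  "qbinom q n k = qpoch q q n / (qpoch q q k * qpoch q q (n - k))"

definition hyp_weight :: "complex list \<Rightarrow> complex list \<Rightarrow> complex \<Rightarrow> nat \<Rightarrow> complex" where
  "hyp_weight as bs q k = qpochs as q k / qpochs bs q k"

text \<open>The exponent \<open>1 + s - r\<close> may be negative, hence the integer power.\<close>

definition hyp_sign :: "complex list \<Rightarrow> complex list \<Rightarrow> complex \<Rightarrow> nat \<Rightarrow> complex" where
  "hyp_sign as bs q k =
     ((-1) ^ k * q ^ (k choose 2)) powi (1 + int (length bs) - int (length as))"

definition basic_hyp_term ::
    "complex list \<Rightarrow> complex list \<Rightarrow> complex \<Rightarrow> complex \<Rightarrow> nat \<Rightarrow> complex" where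
  "basic_hyp_term as bs q z k =
     hyp_weight as bs q k * hyp_sign as bs q k * z ^ k / qpoch q q k"

definition basic_hyp ::
    "complex list \<Rightarrow> complex list \<Rightarrow> complex \<Rightarrow> complex \<Rightarrow> complex" where
  "basic_hyp as bs q z = (\<Sum>k. basic_hyp_term as bs q z k)"

definition cauchy_poly :: "complex \<Rightarrow> nat \<Rightarrow> complex \<Rightarrow> complex \<Rightarrow> complex" where
  "cauchy_poly q n x y = (\<Prod>i<n. x - q ^ i * y)"

text \<open>Generalized \<open>q\<close>-hypergeometric polynomials \<open>\<Psi>\<^sub>n(x,y,z|q)\<close>; the Cauchy polynomial
  takes its arguments in the order \<open>(y,x)\<close>.\<close>

definition gen_hyp_poly ::
    "complex list \<Rightarrow> complex list \<Rightarrow> nat \<Rightarrow> complex \<Rightarrow> complex \<Rightarrow> complex \<Rightarrow> complex \<Rightarrow> complex" where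
  "gen_hyp_poly as bs n x y z q =
     (-1) ^ n * q powi (- int (n choose 2)) *
     (\<Sum>k\<le>n. qbinom q n k * hyp_sign as bs q k * hyp_weight as bs q k *
             cauchy_poly q (n - k) y x * z ^ k)"

text \<open>Al-Salam--Carlitz polynomials \<open>\<psi>\<^sub>n\<^sup>(\<^sup>\<alpha>\<^sup>)(x|q)\<close>.\<close>

definition al_salam_carlitz :: "complex \<Rightarrow> nat \<Rightarrow> complex \<Rightarrow> complex \<Rightarrow> complex" where
  "al_salam_carlitz \<alpha> n x q =
     (\<Sum>k\<le>n. qbinom q n k * q powi (int k * (int k - int n)) *
             qpoch (\<alpha> * q powi (1 - int k)) q k * x ^ k)"

end

theory Submission
  imports Defs
begin

text \<open>
  Let \<open>F\<^sub>m = (-1)\<^sup>m q\<^bsup>m(m-1)/2\<^esup> \<Psi>\<^sub>m / (q;q)\<^sub>m\<close>. By a limit of the \<open>q\<close>-Vandermonde identity,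
  \<open>\<psi>\<^sub>m\<^sup>(\<^sup>\<alpha>\<^sup>)(x|q)\<close> is a series in \<open>n\<close> whose dependence on \<open>m\<close> is just the factor \<open>(x q\<^bsup>-n\<^esup>)\<^sup>m\<close>.
  Inserting it and exchanging summations leaves inner sums \<open>\<Sum>\<^sub>m F\<^sub>m T\<^sup>m\<close> at \<open>T = x t q\<^bsup>1-n\<^esup>\<close>, which the
  identity \<open>(v T;q)\<^sub>\<infinity> \<Sum>\<^sub>m F\<^sub>m T\<^sup>m = (u T;q)\<^sub>\<infinity> \<Phi>(z T)\<close> evaluates. It holds beyond \<open>|v T| < 1\<close>: it is an
  identity of formal power series, and Mertens' theorem applies wherever both sides converge.

  If \<open>(u x t q;q)\<^sub>\<infinity> = 0\<close>, this says nothing about the summability of the right-hand side. In that case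
  \<open>T\<close> is a simple zero of \<open>(u T;q)\<^sub>\<infinity>\<close>, so \<open>\<Phi>(z T)\<close> is read off from
  \<open>\<Sum>\<^sub>m m F\<^sub>m T\<^sup>m\<close>, which equals \<open>\<Sum>\<^sub>m (m - n) F\<^sub>m T\<^sup>m\<close> because \<open>\<Sum>\<^sub>m F\<^sub>m T\<^sup>m = 0\<close>; after this shift the extra
  factor is harmless, since the double series has Gaussian decay in \<open>m - n\<close>.
\<close>

section \<open>The q-Pochhammer symbol\<close>

lemma choose_2_Suc: "(Suc n choose 2) = (n choose 2) + n"
  by (simp add: numeral_2_eq_2)

lemma qpoch_0 [simp]: "qpoch a q 0 = 1"
  by (simp add: qpoch_def)

lemma qpoch_Suc: "qpoch a q (Suc n) = qpoch a q n * (1 - a * q ^ n)"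
  by (simp add: qpoch_def)

lemma qpoch_add: "qpoch a q (m + n) = qpoch a q m * qpoch (a * q ^ m) q n"
  by (induction n) (simp_all add: qpoch_Suc power_add mult_ac)

lemma qpoch_Suc_shift: "qpoch a q (Suc n) = (1 - a) * qpoch (a * q) q n"
  using qpoch_add[of a q 1 n] by (simp add: qpoch_Suc)

lemma qpoch_eq_0_mono: "qpoch a q m = 0 \<Longrightarrow> m \<le> n \<Longrightarrow> qpoch a q n = 0"
  using qpoch_add[of a q m "n - m"] by simp

lemma mult_power_neq_1:
  fixes q :: complex
  assumes "norm q < 1" "norm a < 1"
  shows "a * q ^ n \<noteq> 1"
proof
  assume "a * q ^ n = 1"
  hence "norm a * norm q ^ n = 1"
    by (metis norm_mult norm_power norm_one)
  moreover have "norm a * norm q ^ n \<le> norm a * 1"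
    using assms by (intro mult_left_mono power_le_one) auto
  ultimately show False using assms by simp
qed

lemma qpoch_nonzero:
  assumes "norm q < 1" "norm a < 1"
  shows "qpoch a q n \<noteq> 0"
  using mult_power_neq_1[OF assms] by (auto simp: qpoch_def)

section \<open>Infinite products and bounds for their partial products\<close>

lemma convergent_prod_qpoch:
  assumes "norm q < 1"
  shows "convergent_prod (\<lambda>i. 1 - a * q ^ i :: complex)"
proof -
  have "summable (\<lambda>i. norm a * norm q ^ i)"
    using assms by (intro summable_mult summable_geometric) auto
  hence "abs_convergent_prod (\<lambda>i. 1 - a * q ^ i)"
    by (subst abs_convergent_prod_conv_summable) (simp add: norm_mult norm_power)
  thus ?thesis by (rule abs_convergent_prod_imp_convergent_prod)
qed

lemma tendsto_qpoch_inf: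
  assumes "norm q < 1"
  shows "qpoch a q \<longlonglongrightarrow> qpoch_inf a q"
proof -
  have "(\<lambda>n. qpoch a q (Suc n)) \<longlonglongrightarrow> qpoch_inf a q"
    using convergent_prod_LIMSEQ[OF convergent_prod_qpoch[OF assms, of a]]
    by (simp add: qpoch_def qpoch_inf_def lessThan_Suc_atMost)
  thus ?thesis by (rule LIMSEQ_imp_Suc)
qed

lemma qpoch_inf_split:
  assumes "norm q < 1"
  shows "qpoch_inf a q = qpoch a q n * qpoch_inf (a * q ^ n) q"
proof -
  have "(\<lambda>m. qpoch a q (m + n)) \<longlonglongrightarrow> qpoch a q n * qpoch_inf (a * q ^ n) q"
    using tendsto_mult[OF tendsto_const tendsto_qpoch_inf[OF assms]]
    by (simp add: qpoch_add add.commute[of _ n])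
  moreover have "(\<lambda>m. qpoch a q (m + n)) \<longlonglongrightarrow> qpoch_inf a q"
    by (rule LIMSEQ_ignore_initial_segment[OF tendsto_qpoch_inf[OF assms]])
  ultimately show ?thesis by (rule LIMSEQ_unique[symmetric])
qed

lemma qpoch_inf_eq_0_iff:
  assumes "norm q < 1"
  shows "qpoch_inf a q = 0 \<longleftrightarrow> (\<exists>i. a * q ^ i = 1)"
proof -
  have "(\<lambda>i. 1 - a * q ^ i) has_prod qpoch_inf a q"
    unfolding qpoch_inf_def by (rule convergent_prod_has_prod[OF convergent_prod_qpoch[OF assms]])
  from has_prod_eq_0_iff[OF this] show ?thesis by (auto simp: image_iff)
qed

lemma qpoch_inf_nonzero:
  assumes "norm q < 1" "norm a < 1"
  shows "qpoch_inf a q \<noteq> 0"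
  using mult_power_neq_1[OF assms] by (simp add: qpoch_inf_eq_0_iff assms)

text \<open>The factors are dominated by \<open>1 + M * norm q ^ i\<close>, whose product converges:
  it is the symbol at \<open>- M\<close> with base \<open>norm q\<close>. Uniformity in the
  parameter serves symbols in \<open>c * q ^ n\<close> with varying \<open>n\<close>.\<close>

lemma qpoch_uniform_bound:
  assumes "norm q < 1"
  obtains C where "C > 0" "\<And>a n. norm a \<le> M \<Longrightarrow> norm (qpoch a q n) \<le> C"
proof -
  have "Bseq (qpoch (- of_real M) (of_real (norm q)))"
    using assms by (intro convergent_imp_Bseq convergentI[OF tendsto_qpoch_inf]) simp
  then obtain C where C: "C > 0" "\<And>n. norm (qpoch (- of_real M) (of_real (norm q)) n) \<le> C"
    by (auto simp: Bseq_def)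
  have "norm (qpoch a q n) \<le> C" if "norm a \<le> M" for a n
  proof -
    have "M \<ge> 0" using that norm_ge_zero order_trans by blast
    have "norm (qpoch a q n) = (\<Prod>i<n. norm (1 - a * q ^ i))"
      by (simp add: qpoch_def prod_norm)
    also have "\<dots> \<le> (\<Prod>i<n. 1 + M * norm q ^ i)"
    proof (intro prod_mono conjI)
      fix i
      have "norm (1 - a * q ^ i) \<le> 1 + norm a * norm q ^ i"
        by (metis norm_mult norm_one norm_power norm_triangle_ineq4)
      also have "\<dots> \<le> 1 + M * norm q ^ i"
        using that by (intro add_left_mono mult_right_mono) auto
      finally show "norm (1 - a * q ^ i) \<le> 1 + M * norm q ^ i" .
    qed auto
    also have "\<dots> = (\<Prod>i<n. norm (of_real (1 + M * norm q ^ i) :: complex))"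
      using \<open>M \<ge> 0\<close> by (intro prod.cong refl) (simp only: norm_of_real, simp)
    also have "\<dots> = norm (qpoch (- of_real M) (of_real (norm q)) n)"
      by (simp add: qpoch_def prod_norm)
    finally show ?thesis using C(2)[of n] by simp
  qed
  with C(1) that show ?thesis by blast
qed

text \<open>No factor vanishes, so the limit of the partial products is nonzero and their
  reciprocals converge.\<close>

lemma qpoch_bounded_below:
  assumes "norm q < 1" "\<And>n. qpoch a q n \<noteq> 0"
  obtains c where "c > 0" "\<And>n. c \<le> norm (qpoch a q n)"
proof -
  have "a * q ^ i \<noteq> 1" for i
    using assms(2)[of "Suc i"] by (auto simp: qpoch_Suc)
  hence "qpoch_inf a q \<noteq> 0"
    using qpoch_inf_eq_0_iff[OF assms(1)] by blast
  hence "Bseq (\<lambda>n. inverse (qpoch a q n))"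
    by (intro convergent_imp_Bseq convergentI[OF tendsto_inverse[OF tendsto_qpoch_inf[OF assms(1)]]])
  then obtain C where C: "C > 0" "\<And>n. norm (inverse (qpoch a q n)) \<le> C"
    by (auto simp: Bseq_def)
  have "inverse C \<le> norm (qpoch a q n)" for n
    using C(2)[of n] C(1) assms(2)[of n] by (simp add: norm_divide divide_simps mult.commute)
  with C(1) that[of "inverse C"] show ?thesis by simp
qed

text \<open>Consecutive terms have ratio \<open>A * r ^ k\<close>, which tends to 0: the quadratic
  exponent beats every geometric growth.\<close>

lemma summable_power_times_gauss:
  fixes A r :: real
  assumes "0 \<le> r" "r < 1"
  shows "summable (\<lambda>k. A ^ k * r ^ (k choose 2))"
proof -
  have "(\<lambda>k. \<bar>A\<bar> * r ^ k) \<longlonglongrightarrow> \<bar>A\<bar> * 0"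
    using assms by (intro tendsto_mult tendsto_const LIMSEQ_power_zero) auto
  hence "eventually (\<lambda>k. \<bar>A\<bar> * r ^ k < 1/2) sequentially"
    by (rule order_tendstoD) simp
  then obtain N where N: "\<And>k. k \<ge> N \<Longrightarrow> \<bar>A\<bar> * r ^ k < 1/2"
    by (auto simp: eventually_sequentially)
  show ?thesis
  proof (rule summable_ratio_test[of "1/2" N])
    fix k assume "k \<ge> N"
    have "norm (A ^ Suc k * r ^ (Suc k choose 2)) = (\<bar>A\<bar> * r ^ k) * norm (A ^ k * r ^ (k choose 2))"
      using assms by (simp add: choose_2_Suc power_add abs_mult power_abs)
    also have "\<dots> \<le> 1/2 * norm (A ^ k * r ^ (k choose 2))"
      using N[OF \<open>k \<ge> N\<close>] by (intro mult_right_mono) auto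
    finally show "norm (A ^ Suc k * r ^ (Suc k choose 2)) \<le> 1/2 * norm (A ^ k * r ^ (k choose 2))" .
  qed simp
qed

section \<open>Gaussian binomial coefficients\<close>

lemma qbinom_0 [simp]: "qpoch q q n \<noteq> 0 \<Longrightarrow> qbinom q n 0 = 1"
  and qbinom_self [simp]: "qpoch q q n \<noteq> 0 \<Longrightarrow> qbinom q n n = 1"
  by (simp_all add: qbinom_def)

lemma qbinom_Suc_Suc:
  assumes "norm q < 1" "k < n"
  shows "qbinom q (Suc n) (Suc k) = qbinom q n (Suc k) * q ^ Suc k + qbinom q n k"
    and "qbinom q (Suc n) (Suc k) = qbinom q n (Suc k) + q ^ (n - k) * qbinom q n k"
proof -
  obtain d where n: "n = Suc (k + d)" using less_imp_Suc_add[OF assms(2)] by auto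
  have nz: "qpoch q q m \<noteq> 0" "1 - q * q ^ m \<noteq> 0" for m
    using qpoch_nonzero[OF assms(1), of q] mult_power_neq_1[OF assms(1), of q] assms by auto
  show "qbinom q (Suc n) (Suc k) = qbinom q n (Suc k) * q ^ Suc k + qbinom q n k"
    using nz unfolding n qbinom_def
    by (simp add: qpoch_Suc divide_simps power_add) (simp add: algebra_simps power_add)
  show "qbinom q (Suc n) (Suc k) = qbinom q n (Suc k) + q ^ (n - k) * qbinom q n k"
    using nz unfolding n qbinom_def
    by (simp add: qpoch_Suc divide_simps power_add) (simp add: algebra_simps power_add)
qed

text \<open>The two q-Pascal rules summed against an arbitrary sequence. The first drives the
  induction for q-Vandermonde, the second the one for the Newton expansion of
  \<open>X ^ m\<close>.\<close>

lemma sum_qbinom_Suc: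
  assumes q: "norm q < 1"
  shows "(\<Sum>k\<le>Suc n. qbinom q (Suc n) k * g k)
       = (\<Sum>k\<le>n. qbinom q n k * (q ^ k * g k + g (Suc k)))"
    and "(\<Sum>k\<le>Suc n. qbinom q (Suc n) k * g k)
       = (\<Sum>k\<le>n. qbinom q n k * (g k + q ^ (n - k) * g (Suc k)))"
proof -
  have nz: "qpoch q q m \<noteq> 0" for m using qpoch_nonzero[OF q q] .
  \<comment> \<open>Removing end terms, whose coefficients are 1, leaves sums over
    \<open>k < n\<close>, the range in which the Pascal rules hold.\<close>
  have split: "(\<Sum>k\<le>Suc n. qbinom q (Suc n) k * g k)
      = g 0 + (\<Sum>k<n. qbinom q (Suc n) (Suc k) * g (Suc k)) + g (Suc n)"
    by (subst sum.atMost_Suc_shift) (simp add: nz lessThan_Suc_atMost[symmetric])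
  have low: "(\<Sum>k\<le>n. qbinom q n k * f k) = f 0 + (\<Sum>k<n. qbinom q n (Suc k) * f (Suc k))" for f
    by (cases n) (simp_all add: sum.atMost_Suc_shift nz lessThan_Suc_atMost del: sum.atMost_Suc sum.lessThan_Suc)
  have high: "(\<Sum>k\<le>n. qbinom q n k * f k) = (\<Sum>k<n. qbinom q n k * f k) + f n" for f
    by (simp add: lessThan_Suc_atMost[symmetric] nz)
  show "(\<Sum>k\<le>Suc n. qbinom q (Suc n) k * g k)
       = (\<Sum>k\<le>n. qbinom q n k * (q ^ k * g k + g (Suc k)))"
    unfolding distrib_left sum.distrib split low[of "\<lambda>k. q ^ k * g k"] high[of "\<lambda>k. g (Suc k)"]
    by (simp add: qbinom_Suc_Suc(1)[OF q] sum.distrib[symmetric] algebra_simps)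
  show "(\<Sum>k\<le>Suc n. qbinom q (Suc n) k * g k)
       = (\<Sum>k\<le>n. qbinom q n k * (g k + q ^ (n - k) * g (Suc k)))"
    unfolding distrib_left sum.distrib split low[of g] high[of "\<lambda>k. q ^ (n - k) * g (Suc k)"]
    by (simp add: qbinom_Suc_Suc(2)[OF q] sum.distrib[symmetric] algebra_simps)
qed

section \<open>Cauchy polynomials and the Al-Salam--Carlitz expansion\<close>

lemma cauchy_poly_0 [simp]: "cauchy_poly q 0 x y = 1"
  by (simp add: cauchy_poly_def)

lemma cauchy_poly_Suc: "cauchy_poly q (Suc n) x y = cauchy_poly q n x y * (x - q ^ n * y)"
  by (simp add: cauchy_poly_def)

lemma cauchy_poly_mult: "cauchy_poly q n (a * x) (a * y) = a ^ n * cauchy_poly q n x y"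
  by (induction n) (simp_all add: cauchy_poly_Suc algebra_simps)

lemma cauchy_poly_one: "cauchy_poly q n 1 a = qpoch a q n"
  by (simp add: cauchy_poly_def qpoch_def mult.commute)

lemma cauchy_poly_zero: "cauchy_poly q n x 0 = x ^ n"
  by (simp add: cauchy_poly_def)

lemma norm_cauchy_poly_le:
  assumes "norm q < 1"
  shows "norm (cauchy_poly q n x y) \<le> (norm x + norm y) ^ n"
proof -
  have "norm (x - q ^ i * y) \<le> norm x + norm y" for i
  proof -
    have "norm (x - q ^ i * y) \<le> norm x + norm q ^ i * norm y"
      by (metis norm_mult norm_power norm_triangle_ineq4)
    also have "\<dots> \<le> norm x + 1 * norm y"
      using assms by (intro add_left_mono mult_right_mono power_le_one) auto
    finally show ?thesis by simp
  qed
  hence "(\<Prod>i<n. norm (x - q ^ i * y)) \<le> (\<Prod>i<n. norm x + norm y)"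
    by (intro prod_mono) auto
  thus ?thesis by (simp add: cauchy_poly_def prod_norm)
qed

text \<open>A form of q-Vandermonde with a free parameter \<open>c\<close>. Splitting the factor
  \<open>1 - b\<close> off the front passes from \<open>b\<close> to \<open>q * b\<close>, so the
  induction hypothesis is taken at \<open>q * b\<close> and \<open>q * c\<close>.\<close>

lemma qpoch_eq_sum_cauchy_poly:
  assumes "norm q < 1"
  shows "qpoch b q N = (\<Sum>n\<le>N. qbinom q N n *
    ((-1) ^ n * q ^ (n choose 2) * cauchy_poly q n b c * qpoch (c * q ^ n) q (N - n)))"
proof (induction N arbitrary: b c)
  case 0
  show ?case by (simp add: qbinom_def numeral_2_eq_2)
next
  case (Suc N)
  define g where "g n = (-1) ^ n * q ^ (n choose 2) * cauchy_poly q n b c * qpoch (c * q ^ n) q (Suc N - n)" for n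
  have step: "(1 - b) * ((-1) ^ n * q ^ (n choose 2) * cauchy_poly q n (q * b) (q * c) * qpoch ((q * c) * q ^ n) q (N - n))
      = q ^ n * g n + g (Suc n)" if "n \<le> N" for n
  proof -
    \<comment> \<open>The first bracket extends the Pochhammer symbol at its front and gives
      \<open>q ^ n * g n\<close>; the second is the next factor of the Cauchy polynomial and gives
      \<open>g (Suc n)\<close>.\<close>
    have "1 - b = (1 - c * q ^ n) - (b - q ^ n * c)" by simp
    moreover have "Suc N - n = Suc (N - n)" using that by simp
    ultimately show ?thesis
      unfolding g_def
      by (simp add: cauchy_poly_mult cauchy_poly_Suc qpoch_Suc_shift choose_2_Suc power_add)
         (simp add: algebra_simps)
  qed
  have "qpoch b q (Suc N) = (1 - b) * qpoch (q * b) q N"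
    by (simp add: qpoch_Suc_shift mult.commute)
  also have "\<dots> = (\<Sum>n\<le>N. qbinom q N n * ((1 - b) *
      ((-1) ^ n * q ^ (n choose 2) * cauchy_poly q n (q * b) (q * c) * qpoch ((q * c) * q ^ n) q (N - n))))"
    by (subst Suc.IH[of "q * b" "q * c"]) (simp add: sum_distrib_left mult_ac)
  also have "\<dots> = (\<Sum>n\<le>N. qbinom q N n * (q ^ n * g n + g (Suc n)))"
    by (intro sum.cong refl) (simp only: step atMost_iff)
  also have "\<dots> = (\<Sum>n\<le>Suc N. qbinom q (Suc N) n * g n)"
    by (rule sum_qbinom_Suc(1)[OF assms, symmetric])
  finally show ?case by (simp only: g_def)
qed

text \<open>The limit of the finite identity as \<open>N\<close> tends to infinity, by Tannery's
  theorem with a Gaussian majorant. The case \<open>c = 0\<close> is Euler's expansion of the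
  infinite product.\<close>

lemma qpoch_inf_sums_cauchy_poly:
  assumes q: "norm q < 1"
  shows "(\<lambda>n. (-1) ^ n * q ^ (n choose 2) * cauchy_poly q n b c / qpoch q q n * qpoch_inf (c * q ^ n) q)
    sums qpoch_inf b q"
    and "summable (\<lambda>n. norm ((-1) ^ n * q ^ (n choose 2) * cauchy_poly q n b c / qpoch q q n * qpoch_inf (c * q ^ n) q))"
proof -
  define s where "s n = (-1) ^ n * q ^ (n choose 2) * cauchy_poly q n b c" for n
  define a where "a n N = (if n \<le> N then qbinom q N n * (s n * qpoch (c * q ^ n) q (N - n)) else 0)" for n N
  define l where "l n = s n / qpoch q q n * qpoch_inf (c * q ^ n) q" for n
  have nz: "qpoch q q n \<noteq> 0" for n using qpoch_nonzero[OF q q] .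
  obtain C where C: "C > 0" "\<And>a n. norm a \<le> max (norm q) (norm c) \<Longrightarrow> norm (qpoch a q n) \<le> C"
    using qpoch_uniform_bound[OF q] by blast
  obtain d where d: "d > 0" "\<And>n. d \<le> norm (qpoch q q n)"
    using qpoch_bounded_below[OF q nz] by blast
  \<comment> \<open>\<open>C\<close> bounds both \<open>qpoch q q N\<close> and the symbol in
    \<open>c * q ^ n\<close>; \<open>d\<close> bounds the two denominators of the Gaussian binomial
    from below.\<close>
  define M where "M n = C / (d * d) * ((norm b + norm c) ^ n * norm q ^ (n choose 2)) * C" for n
  have lim: "(\<lambda>N. a n N) \<longlonglongrightarrow> l n" for n
  proof -
    have shift: "(\<lambda>N. qpoch y q (N - n)) \<longlonglongrightarrow> qpoch_inf y q" for y
      by (rule LIMSEQ_offset[of _ n]) (simp add: tendsto_qpoch_inf[OF q])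
    have "(\<lambda>N. qpoch q q N / (qpoch q q n * qpoch q q (N - n)) * (s n * qpoch (c * q ^ n) q (N - n)))
        \<longlonglongrightarrow> qpoch_inf q q / (qpoch q q n * qpoch_inf q q) * (s n * qpoch_inf (c * q ^ n) q)"
      using nz qpoch_inf_nonzero[OF q q]
      by (intro tendsto_intros shift tendsto_qpoch_inf[OF q]) auto
    moreover have "eventually (\<lambda>N. a n N = qpoch q q N / (qpoch q q n * qpoch q q (N - n)) * (s n * qpoch (c * q ^ n) q (N - n))) sequentially"
      using eventually_ge_at_top[of n] by eventually_elim (simp add: a_def qbinom_def)
    ultimately show ?thesis
      using qpoch_inf_nonzero[OF q q] by (simp add: l_def filterlim_cong[OF refl refl])
  qed
  have bound: "norm (a n N) \<le> M n" for n N
  proof (cases "n \<le> N")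
    case True
    have cq: "norm (c * q ^ n) \<le> norm c"
      using q by (simp add: norm_mult norm_power mult_left_le power_le_one)
    have "norm (qbinom q N n) \<le> C / (d * d)"
      unfolding qbinom_def norm_divide norm_mult
      using C d by (intro frac_le mult_mono mult_pos_pos) (auto intro: less_imp_le)
    moreover have "norm (s n) \<le> (norm b + norm c) ^ n * norm q ^ (n choose 2)"
      using norm_cauchy_poly_le[OF q, of n b c]
      by (simp add: s_def norm_mult norm_power mult.commute mult_right_mono)
    moreover have "norm (qpoch (c * q ^ n) q (N - n)) \<le> C"
      using cq by (intro C(2)) auto
    ultimately have "norm (qbinom q N n) * norm (s n) * norm (qpoch (c * q ^ n) q (N - n)) \<le> M n"
      using C(1) d(1) unfolding M_def by (intro mult_mono) auto
    thus ?thesis using True by (simp add: a_def norm_mult mult.assoc)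
  next
    case False
    thus ?thesis using C(1) d(1) by (simp add: a_def M_def)
  qed
  have "summable M"
    unfolding M_def using q by (intro summable_mult summable_mult2 summable_power_times_gauss) auto
  moreover have "eventually (\<lambda>(n, N). norm (a n N) \<le> M n) (at_top \<times>\<^sub>F sequentially)"
    using bound by (intro always_eventually) auto
  ultimately have T: "summable (\<lambda>n. norm (l n))" "(\<lambda>N. \<Sum>n. a n N) \<longlonglongrightarrow> suminf l"
    using tannerys_theorem[of a l sequentially M] lim by auto
  have "(\<Sum>n. a n N) = qpoch b q N" for N
  proof -
    have "(\<Sum>n. a n N) = (\<Sum>n\<le>N. a n N)" by (rule suminf_finite) (auto simp: a_def)
    thus ?thesis
      by (simp add: a_def s_def qpoch_eq_sum_cauchy_poly[OF q, of b N c])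
  qed
  with T(2) have "suminf l = qpoch_inf b q"
    using LIMSEQ_unique tendsto_qpoch_inf[OF q, of b] by force
  with T(1) have "l sums qpoch_inf b q"
    using summable_norm_cancel summable_sums by metis
  thus "(\<lambda>n. (-1) ^ n * q ^ (n choose 2) * cauchy_poly q n b c / qpoch q q n * qpoch_inf (c * q ^ n) q)
    sums qpoch_inf b q" by (simp only: l_def[abs_def] s_def[abs_def])
  show "summable (\<lambda>n. norm ((-1) ^ n * q ^ (n choose 2) * cauchy_poly q n b c / qpoch q q n * qpoch_inf (c * q ^ n) q))"
    using T(1) by (simp add: l_def s_def)
qed

lemma qpoch_inf_zero [simp]: "qpoch_inf 0 q = 1"
  by (simp add: qpoch_inf_def)

text \<open>Euler's Taylor coefficients in \<open>w\<close> of the entire function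
  \<open>qpoch_inf (b * w) q\<close>.\<close>

definition euler_coeff :: "complex \<Rightarrow> complex \<Rightarrow> nat \<Rightarrow> complex" where
  "euler_coeff q b n = (-1) ^ n * q ^ (n choose 2) * b ^ n / qpoch q q n"

lemma euler_coeff_sums:
  assumes "norm q < 1"
  shows "(\<lambda>n. euler_coeff q b n * w ^ n) sums qpoch_inf (b * w) q"
    and "summable (\<lambda>n. norm (euler_coeff q b n * w ^ n))"
  using qpoch_inf_sums_cauchy_poly[OF assms, of "b * w" 0]
  by (simp_all add: euler_coeff_def cauchy_poly_zero power_mult_distrib mult_ac)

lemma isCont_qpoch_inf:
  assumes "norm q < 1"
  shows "isCont (\<lambda>a. qpoch_inf a q) w"
proof -
  have "isCont (\<lambda>w. \<Sum>n. euler_coeff q 1 n * w ^ n) w"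
    by (rule isCont_powser_converges_everywhere) (rule sums_summable[OF euler_coeff_sums(1)[OF assms]])
  moreover have "(\<Sum>n. euler_coeff q 1 n * w ^ n) = qpoch_inf w q" for w
    using sums_unique[OF euler_coeff_sums(1)[OF assms, of 1 w]] by simp
  ultimately show ?thesis by simp
qed

text \<open>Newton expansion at the nodes \<open>1 / q ^ j\<close>. In the induction the second
  Pascal rule pairs \<open>A k\<close> with \<open>A k * (X - 1 / q ^ k)\<close>; the terms with
  \<open>1 / q ^ k\<close> cancel and a factor \<open>X\<close> remains.\<close>

lemma power_eq_sum_qbinom:
  assumes "norm q < 1" "q \<noteq> 0"
  shows "(\<Sum>k\<le>m. qbinom q m k * ((\<Prod>j<k. X - 1 / q ^ j) / q ^ (k * (m - k)))) = X ^ m"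
proof (induction m)
  case 0
  show ?case by (simp add: qbinom_def)
next
  case (Suc m)
  define A where "A k = (\<Prod>j<k. X - 1 / q ^ j)" for k
  have "(\<Sum>k\<le>Suc m. qbinom q (Suc m) k * (A k / q ^ (k * (Suc m - k))))
     = (\<Sum>k\<le>m. qbinom q m k * (A k / q ^ (k * (Suc m - k)) + q ^ (m - k) * (A (Suc k) / q ^ (Suc k * (Suc m - Suc k)))))"
    by (rule sum_qbinom_Suc(2)[OF assms(1)])
  also have "\<dots> = (\<Sum>k\<le>m. X * (qbinom q m k * (A k / q ^ (k * (m - k)))))"
  proof (intro sum.cong refl)
    fix k assume "k \<in> {..m}"
    then obtain d where "m = k + d" using le_Suc_ex by auto
    moreover have "A (Suc k) = A k * (X - 1 / q ^ k)" by (simp add: A_def)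
    ultimately show "qbinom q m k * (A k / q ^ (k * (Suc m - k)) + q ^ (m - k) * (A (Suc k) / q ^ (Suc k * (Suc m - Suc k))))
        = X * (qbinom q m k * (A k / q ^ (k * (m - k))))"
      using assms(2) by (simp add: power_add field_simps)
  qed
  also have "\<dots> = X ^ Suc m"
    by (simp only: sum_distrib_left[symmetric] A_def Suc.IH power_Suc)
  finally show ?case by (simp add: A_def)
qed

lemma prod_diff_inverse_power:
  assumes "q \<noteq> 0" "X \<noteq> 0"
  shows "(\<Prod>j<k. X - 1 / q ^ j) = X ^ k * qpoch (q / q ^ k / X) q k"
proof -
  have "(\<Prod>j<k. X - 1 / q ^ j) = (\<Prod>j<k. X - 1 / q ^ (k - Suc j))"
    by (rule prod.nat_diff_reindex[symmetric])
  also have "\<dots> = (\<Prod>j<k. X * (1 - q / q ^ k / X * q ^ j))"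
  proof (intro prod.cong refl)
    fix j assume "j \<in> {..<k}"
    hence "q ^ k = q ^ (k - Suc j) * q ^ Suc j"
      by (simp add: power_add[symmetric] del: power_Suc)
    thus "X - 1 / q ^ (k - Suc j) = X * (1 - q / q ^ k / X * q ^ j)"
      using assms by (simp add: field_simps)
  qed
  finally show ?thesis by (simp add: prod.distrib qpoch_def)
qed

text \<open>The product at \<open>b = \<alpha> * q / q ^ k\<close> is expanded with
  \<open>c = q / x / q ^ k\<close>. Since \<open>c / b = 1 / (\<alpha> * x)\<close> does not depend
  on \<open>k\<close>, the finite sum over \<open>k\<close> can be carried out for each
  \<open>n\<close>, where the Newton expansion collapses it to
  \<open>(x / q ^ n) ^ m\<close>.\<close>

lemma al_salam_carlitz_sums:
  assumes q: "0 < norm q" "norm q < 1" and nz: "\<alpha> \<noteq> 0" "x \<noteq> 0"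
  shows "(\<lambda>n. (-1) ^ n * q ^ (n choose 2) * qpoch (1 / (\<alpha> * x)) q n / qpoch q q n * (\<alpha> * q) ^ n
             * qpoch_inf (q / x * q ^ n) q * (x / q ^ n) ^ m)
         sums (qpoch_inf (\<alpha> * q) q * al_salam_carlitz \<alpha> m x q)"
proof -
  have q0: "q \<noteq> 0" using q by auto
  define w where "w k = qbinom q m k / q ^ (k * (m - k)) * x ^ k" for k
  define s where "s n = (-1) ^ n * q ^ (n choose 2) * qpoch (1 / (\<alpha> * x)) q n / qpoch q q n * (\<alpha> * q) ^ n" for n
  have cp: "cauchy_poly q n (\<alpha> * q / q ^ k) (q / x / q ^ k) = (\<alpha> * q / q ^ k) ^ n * qpoch (1 / (\<alpha> * x)) q n" for n k
    using cauchy_poly_mult[of q n "\<alpha> * q / q ^ k" 1 "1 / (\<alpha> * x)"] nz q0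
    by (simp add: cauchy_poly_one mult.commute)
  have "(\<lambda>n. \<Sum>k\<le>m. w k * ((-1) ^ n * q ^ (n choose 2) * cauchy_poly q n (\<alpha> * q / q ^ k) (q / x / q ^ k) / qpoch q q n
            * qpoch_inf (q / x / q ^ k * q ^ n) q)) sums (\<Sum>k\<le>m. w k * qpoch_inf (\<alpha> * q / q ^ k) q)"
    by (intro sums_sum sums_mult qpoch_inf_sums_cauchy_poly q)
  moreover have "(\<Sum>k\<le>m. w k * ((-1) ^ n * q ^ (n choose 2) * cauchy_poly q n (\<alpha> * q / q ^ k) (q / x / q ^ k) / qpoch q q n
            * qpoch_inf (q / x / q ^ k * q ^ n) q))
        = s n * qpoch_inf (q / x * q ^ n) q * (x / q ^ n) ^ m" for n
  proof -
    define X where "X = x / q ^ n"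
    have X: "X \<noteq> 0" using nz q0 by (simp add: X_def)
    have "w k * ((-1) ^ n * q ^ (n choose 2) * cauchy_poly q n (\<alpha> * q / q ^ k) (q / x / q ^ k) / qpoch q q n
            * qpoch_inf (q / x / q ^ k * q ^ n) q)
        = s n * qpoch_inf (q / x * q ^ n) q * (qbinom q m k * ((\<Prod>j<k. X - 1 / q ^ j) / q ^ (k * (m - k))))" for k
    proof -
      \<comment> \<open>The first \<open>k\<close> factors are the symbol of the Newton product at
        \<open>X\<close>; the remaining product is free of \<open>k\<close>.\<close>
      have "qpoch_inf (q / x / q ^ k * q ^ n) q = qpoch (q / q ^ k / X) q k * qpoch_inf (q / x * q ^ n) q"
        using q0 by (subst qpoch_inf_split[OF q(2), of _ k]) (simp add: X_def mult.commute)
      moreover have "X ^ k = x ^ k / (q ^ k) ^ n"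
        by (simp add: X_def power_divide power_mult[symmetric] mult.commute)
      ultimately show ?thesis
        unfolding prod_diff_inverse_power[OF q0 X] cp w_def s_def
        by (simp add: power_divide mult_ac)
    qed
    thus ?thesis
      by (simp only: sum_distrib_left[symmetric] power_eq_sum_qbinom[OF q(2) q0] X_def[symmetric])
  qed
  moreover have "(\<Sum>k\<le>m. w k * qpoch_inf (\<alpha> * q / q ^ k) q) = qpoch_inf (\<alpha> * q) q * al_salam_carlitz \<alpha> m x q"
  proof -
    have "w k * qpoch_inf (\<alpha> * q / q ^ k) q = qpoch_inf (\<alpha> * q) q *
        (qbinom q m k * q powi (int k * (int k - int m)) * qpoch (\<alpha> * q powi (1 - int k)) q k * x ^ k)" if "k \<le> m" for k
    proof -
      have "int k * (int k - int m) = - int (k * (m - k))"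
        using that by (simp add: of_nat_diff algebra_simps)
      hence "q powi (int k * (int k - int m)) = 1 / q ^ (k * (m - k))"
        by (simp only: power_int_minus power_int_of_nat) (simp add: inverse_eq_divide)
      moreover have "\<alpha> * q powi (1 - int k) = \<alpha> * q / q ^ k"
        using q0 by (simp add: power_int_diff)
      ultimately show ?thesis
        using q0 by (subst qpoch_inf_split[OF q(2), of _ k]) (simp add: w_def)
    qed
    thus ?thesis by (simp add: al_salam_carlitz_def sum_distrib_left)
  qed
  ultimately show ?thesis by (simp add: s_def)
qed

section \<open>The generating function of the generalized polynomials\<close>

text \<open>The partial sums of the product are sums of \<open>a k * s (N - k)\<close>, with
  \<open>s\<close> the bounded partial sums of \<open>b\<close>, so \<open>norm (a k) * K\<close> is
  a Tannery majorant. Requiring absolute convergence of one factor only allows a merely convergent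
  hypergeometric series.\<close>

lemma Cauchy_product_sums_Mertens:
  fixes a b :: "nat \<Rightarrow> 'a :: {real_normed_algebra, banach}"
  assumes a: "summable (\<lambda>n. norm (a n))" and b: "b sums B"
  shows "(\<lambda>n. \<Sum>k\<le>n. a k * b (n - k)) sums (suminf a * B)"
proof -
  define s where "s n = (\<Sum>j<n. b j)" for n
  have s: "s \<longlonglongrightarrow> B" using b by (simp add: sums_def s_def[abs_def])
  obtain K where K: "\<And>n. norm (s n) \<le> K"
    using convergent_imp_Bseq[OF convergentI[OF s]] by (auto simp: Bseq_def)
  define f where "f k N = (if k < N then a k * s (N - k) else 0)" for k N
  have "(\<lambda>N. f k N) \<longlonglongrightarrow> a k * B" for k
  proof -
    have "(\<lambda>N. s (N - k)) \<longlonglongrightarrow> B"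
      by (rule LIMSEQ_offset[of _ k]) (simp add: s)
    hence "(\<lambda>N. a k * s (N - k)) \<longlonglongrightarrow> a k * B" by (intro tendsto_intros)
    moreover have "eventually (\<lambda>N. f k N = a k * s (N - k)) sequentially"
      using eventually_gt_at_top[of k] by eventually_elim (simp add: f_def)
    ultimately show ?thesis by (simp add: filterlim_cong[OF refl refl])
  qed
  moreover have "eventually (\<lambda>(k, N). norm (f k N) \<le> norm (a k) * K) (at_top \<times>\<^sub>F sequentially)"
  proof (intro always_eventually, clarify)
    fix k N
    have "0 \<le> K" using K norm_ge_zero order_trans by blast
    moreover have "norm (a k * s (N - k)) \<le> norm (a k) * K"
      by (rule order_trans[OF norm_mult_ineq]) (intro mult_left_mono K norm_ge_zero)
    ultimately show "norm (f k N) \<le> norm (a k) * K" by (simp add: f_def)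
  qed
  ultimately have "(\<lambda>N. \<Sum>k. f k N) \<longlonglongrightarrow> (\<Sum>k. a k * B)"
    using tannerys_theorem[of f "\<lambda>k. a k * B" sequentially "\<lambda>k. norm (a k) * K"] summable_mult2[OF a]
    by auto
  moreover have "(\<Sum>k. a k * B) = suminf a * B"
    by (rule suminf_mult2[symmetric, OF summable_norm_cancel[OF a]])
  moreover have "(\<Sum>k. f k N) = (\<Sum>n<N. \<Sum>k\<le>n. a k * b (n - k))" for N
  proof -
    have "(\<Sum>k. f k N) = (\<Sum>k<N. a k * s (N - k))"
      by (subst suminf_finite[of "{..<N}"]) (auto simp: f_def)
    also have "\<dots> = (\<Sum>n<N. \<Sum>k\<le>n. a k * b (n - k))"
    proof (induction N)
      case (Suc N)
      have "(\<Sum>k<Suc N. a k * s (Suc N - k)) = (\<Sum>k<N. a k * s (N - k) + a k * b (N - k)) + a N * b 0"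
        by (simp add: s_def Suc_diff_le distrib_left)
      also have "\<dots> = (\<Sum>k<N. a k * s (N - k)) + (\<Sum>k\<le>N. a k * b (N - k))"
        by (simp add: sum.distrib lessThan_Suc_atMost[symmetric] add.assoc)
      finally show ?case using Suc.IH by simp
    qed simp
    finally show ?thesis .
  qed
  ultimately show ?thesis by (simp add: sums_def)
qed

text \<open>By the q-binomial theorem, the coefficients in \<open>T\<close> of
  \<open>qpoch_inf (u * T) q / qpoch_inf (v * T) q\<close>.\<close>

definition cauchy_coeff :: "complex \<Rightarrow> complex \<Rightarrow> complex \<Rightarrow> nat \<Rightarrow> complex" where
  "cauchy_coeff q v u j = cauchy_poly q j v u / qpoch q q j"

text \<open>The q-binomial theorem with denominator cleared, as an identity of coefficients. Both
  sequences obey first-order recurrences, and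
  \<open>1 - q ^ m = (1 - q ^ (m - i)) + q ^ (m - i) * (1 - q ^ i)\<close> lets one act on each
  part.\<close>

lemma cauchy_coeff_euler_coeff:
  assumes q: "norm q < 1"
  shows "(\<Sum>i\<le>m. cauchy_coeff q v u i * euler_coeff q v (m - i)) = euler_coeff q u m"
proof (induction m)
  case 0
  show ?case by (simp add: cauchy_coeff_def euler_coeff_def)
next
  case (Suc m)
  have nz: "1 - q * q ^ j \<noteq> 0" for j
    using mult_power_neq_1[OF q q, of j] by auto
  let ?p = "cauchy_coeff q v u" and ?e = "euler_coeff q v"
  have p: "(1 - q ^ Suc i) * ?p (Suc i) = (v - q ^ i * u) * ?p i" for i
    using nz[of i] by (simp add: cauchy_coeff_def cauchy_poly_Suc qpoch_Suc)
  have e: "(1 - q ^ Suc j) * euler_coeff q b (Suc j) = - (q ^ j * b) * euler_coeff q b j" for j b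
    using nz[of j] by (simp add: euler_coeff_def qpoch_Suc choose_2_Suc power_add)
  have "(1 - q ^ Suc m) * (\<Sum>i\<le>Suc m. ?p i * ?e (Suc m - i))
      = (\<Sum>i\<le>Suc m. ?p i * ((1 - q ^ (Suc m - i)) * ?e (Suc m - i)))
      + (\<Sum>i\<le>Suc m. q ^ (Suc m - i) * ?e (Suc m - i) * ((1 - q ^ i) * ?p i))"
    unfolding sum.distrib[symmetric] sum_distrib_left
  proof (intro sum.cong refl)
    fix i assume "i \<in> {..Suc m}"
    hence "q ^ Suc m = q ^ (Suc m - i) * q ^ i"
      by (simp add: power_add[symmetric] del: power_Suc)
    thus "(1 - q ^ Suc m) * (?p i * ?e (Suc m - i)) = ?p i * ((1 - q ^ (Suc m - i)) * ?e (Suc m - i))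
      + q ^ (Suc m - i) * ?e (Suc m - i) * ((1 - q ^ i) * ?p i)"
      by (simp only:) (simp add: algebra_simps)
  qed
  \<comment> \<open>The term \<open>i = Suc m\<close> vanishes here, and the term
    \<open>i = 0\<close> in the second sum, so both reduce to \<open>m + 1\<close> terms.\<close>
  also have "(\<Sum>i\<le>Suc m. ?p i * ((1 - q ^ (Suc m - i)) * ?e (Suc m - i)))
      = (\<Sum>i\<le>m. ?p i * (- (q ^ (m - i) * v) * ?e (m - i)))"
    by (simp add: Suc_diff_le e[unfolded power_Suc] cong: sum.cong_simp)
  also have "(\<Sum>i\<le>Suc m. q ^ (Suc m - i) * ?e (Suc m - i) * ((1 - q ^ i) * ?p i))
      = (\<Sum>i\<le>m. q ^ (m - i) * ?e (m - i) * ((v - q ^ i * u) * ?p i))"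
    by (subst sum.atMost_Suc_shift) (simp add: p[unfolded power_Suc])
  \<comment> \<open>The contributions of \<open>v\<close> cancel, leaving the recurrence of
    \<open>euler_coeff q u\<close>.\<close>
  also have "(\<Sum>i\<le>m. ?p i * (- (q ^ (m - i) * v) * ?e (m - i)))
      + (\<Sum>i\<le>m. q ^ (m - i) * ?e (m - i) * ((v - q ^ i * u) * ?p i))
      = (\<Sum>i\<le>m. - (q ^ m * u) * (?p i * ?e (m - i)))"
    unfolding sum.distrib[symmetric]
  proof (intro sum.cong refl)
    fix i assume "i \<in> {..m}"
    hence "q ^ m = q ^ (m - i) * q ^ i" by (simp add: power_add[symmetric])
    thus "?p i * (- (q ^ (m - i) * v) * ?e (m - i)) + q ^ (m - i) * ?e (m - i) * ((v - q ^ i * u) * ?p i)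
        = - (q ^ m * u) * (?p i * ?e (m - i))"
      by (simp only:) (simp add: algebra_simps)
  qed
  also have "\<dots> = (1 - q ^ Suc m) * euler_coeff q u (Suc m)"
    unfolding sum_distrib_left[symmetric] Suc.IH e ..
  finally show ?case using nz[of m] by simp
qed

definition hyp_coeff :: "complex list \<Rightarrow> complex list \<Rightarrow> complex \<Rightarrow> nat \<Rightarrow> complex" where
  "hyp_coeff as bs q k = hyp_weight as bs q k * hyp_sign as bs q k / qpoch q q k"

lemma basic_hyp_term_eq: "basic_hyp_term as bs q w k = hyp_coeff as bs q k * w ^ k"
  by (simp add: basic_hyp_term_def hyp_coeff_def)

definition gen_hyp_coeff ::
    "complex list \<Rightarrow> complex list \<Rightarrow> complex \<Rightarrow> complex \<Rightarrow> complex \<Rightarrow> complex \<Rightarrow> nat \<Rightarrow> complex" where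
  "gen_hyp_coeff as bs u v z q m
     = gen_hyp_poly as bs m u v z q * (-1) ^ m * q ^ (m choose 2) / qpoch q q m"

text \<open>The normalisation cancels the prefactor of the polynomial, and the Gaussian binomial
  supplies the denominators of both sequences.\<close>

lemma gen_hyp_coeff_eq:
  assumes "norm q < 1" "q \<noteq> 0"
  shows "gen_hyp_coeff as bs u v z q m
    = (\<Sum>k\<le>m. (hyp_coeff as bs q k * z ^ k) * cauchy_coeff q v u (m - k))"
proof -
  have nz: "qpoch q q n \<noteq> 0" for n using qpoch_nonzero[OF assms(1) assms(1)] .
  have "(-1) ^ m * q powi (- int (m choose 2)) * ((-1) ^ m * q ^ (m choose 2)) = 1"
    using assms(2) by (simp add: power_int_minus power_mult_distrib[symmetric] field_simps)
  hence "gen_hyp_coeff as bs u v z q m = (\<Sum>k\<le>m. qbinom q m k * hyp_sign as bs q k * hyp_weight as bs q k *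
             cauchy_poly q (m - k) v u * z ^ k) / qpoch q q m"
    unfolding gen_hyp_coeff_def gen_hyp_poly_def
    by (simp add: field_simps nz)
  thus ?thesis
    using nz by (simp add: sum_divide_distrib qbinom_def hyp_coeff_def cauchy_coeff_def field_simps)
qed

text \<open>Both sides are Cauchy products with one absolutely convergent factor, the series
  \<open>F\<close> on the left and Euler's on the right; the formal identity makes their
  coefficients equal.\<close>

lemma gen_hyp_coeff_generating_function:
  assumes q: "norm q < 1" "q \<noteq> 0"
    and F: "summable (\<lambda>m. norm (gen_hyp_coeff as bs u v z q m * T ^ m))"
    and Phi: "summable (basic_hyp_term as bs q (z * T))"
  shows "(\<Sum>m. gen_hyp_coeff as bs u v z q m * T ^ m) * qpoch_inf (v * T) q
       = qpoch_inf (u * T) q * basic_hyp as bs q (z * T)"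
proof -
  let ?F = "gen_hyp_coeff as bs u v z q"
  define P where "P = Abs_fps (cauchy_coeff q v u)"
  define E where "E b = Abs_fps (euler_coeff q b)" for b
  define H where "H = Abs_fps (\<lambda>k. hyp_coeff as bs q k * z ^ k)"
  have "P * E v = E u"
    by (rule fps_ext) (simp add: fps_mult_nth P_def E_def atLeast0AtMost cauchy_coeff_euler_coeff[OF q(1)])
  moreover have "Abs_fps ?F = H * P"
    by (rule fps_ext) (simp add: fps_mult_nth P_def H_def atLeast0AtMost gen_hyp_coeff_eq[OF q])
  ultimately have eq: "Abs_fps ?F * E v = E u * H"
    by (simp add: mult_ac)
  have coeff: "(\<Sum>k\<le>n. (f k * T ^ k) * (g (n - k) * T ^ (n - k))) = fps_nth (Abs_fps f * Abs_fps g) n * T ^ n" for f g n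
  proof -
    have "(\<Sum>k\<le>n. (f k * T ^ k) * (g (n - k) * T ^ (n - k))) = (\<Sum>k\<le>n. f k * g (n - k) * T ^ n)"
    proof (intro sum.cong refl)
      fix k assume "k \<in> {..n}"
      hence "T ^ n = T ^ k * T ^ (n - k)" by (simp add: power_add[symmetric])
      thus "(f k * T ^ k) * (g (n - k) * T ^ (n - k)) = f k * g (n - k) * T ^ n" by simp
    qed
    thus ?thesis by (simp add: fps_mult_nth atLeast0AtMost sum_distrib_right)
  qed
  have "(\<lambda>n. \<Sum>k\<le>n. (?F k * T ^ k) * (euler_coeff q v (n - k) * T ^ (n - k))) sums
      ((\<Sum>m. ?F m * T ^ m) * qpoch_inf (v * T) q)"
    by (rule Cauchy_product_sums_Mertens[OF F euler_coeff_sums(1)[OF q(1)]])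
  moreover have "(\<lambda>n. \<Sum>k\<le>n. (euler_coeff q u k * T ^ k) * ((hyp_coeff as bs q (n - k) * z ^ (n - k)) * T ^ (n - k))) sums
      (suminf (\<lambda>m. euler_coeff q u m * T ^ m) * basic_hyp as bs q (z * T))"
  proof -
    have "(\<lambda>k. (hyp_coeff as bs q k * z ^ k) * T ^ k) sums basic_hyp as bs q (z * T)"
      using summable_sums[OF Phi]
      by (simp add: basic_hyp_def basic_hyp_term_eq[abs_def] power_mult_distrib mult.assoc)
    thus ?thesis
      by (rule Cauchy_product_sums_Mertens[OF euler_coeff_sums(2)[OF q(1)]])
  qed
  moreover have "suminf (\<lambda>m. euler_coeff q u m * T ^ m) = qpoch_inf (u * T) q"
    by (rule sums_unique[symmetric, OF euler_coeff_sums(1)[OF q(1)]])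
  ultimately have "(\<lambda>n. fps_nth (E u * H) n * T ^ n) sums ((\<Sum>m. ?F m * T ^ m) * qpoch_inf (v * T) q)"
      "(\<lambda>n. fps_nth (E u * H) n * T ^ n) sums (qpoch_inf (u * T) q * basic_hyp as bs q (z * T))"
    unfolding coeff[of ?F "euler_coeff q v"] coeff[of "euler_coeff q u" "\<lambda>k. hyp_coeff as bs q k * z ^ k"]
    by (simp_all only: E_def H_def eq[unfolded E_def H_def])
  thus ?thesis by (rule sums_unique2)
qed

section \<open>Double series\<close>

text \<open>Fubini for absolutely summable double families, carried over from unordered sums to
  \<open>suminf\<close>.\<close>

lemma
  fixes f :: "nat \<Rightarrow> nat \<Rightarrow> 'a :: banach"
  assumes "(\<lambda>(n, m). norm (f n m)) summable_on UNIV"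
  shows abs_double_sum_row: "summable (\<lambda>m. norm (f n m))"
    and abs_double_sum_rows: "summable (\<lambda>n. \<Sum>m. f n m)"
    and abs_double_sum_swap: "(\<And>m. (\<lambda>n. f n m) sums l m) \<Longrightarrow> summable l \<and> suminf l = (\<Sum>n. \<Sum>m. f n m)"
proof -
  have abs: "(\<lambda>p. norm (case p of (n, m) \<Rightarrow> f n m)) summable_on UNIV \<times> UNIV"
    using assms by (simp add: case_prod_unfold)
  have sum: "(\<lambda>(n, m). f n m) summable_on UNIV \<times> UNIV"
    using abs by (rule abs_summable_summable)
  have sum': "(\<lambda>(m, n). f n m) summable_on UNIV \<times> UNIV"
    using sum by (subst (asm) summable_on_swap) (simp add: case_prod_unfold)
  have abs': "(\<lambda>p. norm (case p of (m, n) \<Rightarrow> f n m)) summable_on UNIV \<times> UNIV"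
    using abs by (subst (asm) summable_on_swap) (simp add: case_prod_unfold)
  have row: "(\<lambda>m. norm (f n m)) summable_on UNIV" for n
    using bspec[OF conjunct1[OF iffD1[OF Infinite_Sum.abs_summable_on_Sigma_iff abs]] UNIV_I, of n]
    by (simp only: prod.case)
  have col: "(\<lambda>n. f n m) summable_on UNIV" for m
    using bspec[OF conjunct1[OF iffD1[OF Infinite_Sum.abs_summable_on_Sigma_iff abs']] UNIV_I, of m]
    unfolding prod.case by (rule abs_summable_summable)
  show "summable (\<lambda>m. norm (f n m))" for n
    by (rule summable_on_imp_summable[OF row])
  have r: "infsum (f n) UNIV = (\<Sum>m. f n m)" for n
    using abs_summable_summable[OF row] has_sum_imp_sums[OF has_sum_infsum] sums_unique by blast
  have rows: "(\<lambda>n. \<Sum>m. f n m) summable_on UNIV"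
    using summable_on_Sigma_banach[of f UNIV "\<lambda>_. UNIV"] sum by (simp add: r)
  show "summable (\<lambda>n. \<Sum>m. f n m)"
    by (rule summable_on_imp_summable[OF rows])
  show "summable l \<and> suminf l = (\<Sum>n. \<Sum>m. f n m)" if l: "\<And>m. (\<lambda>n. f n m) sums l m"
  proof -
    have c: "infsum (\<lambda>n. f n m) UNIV = l m" for m
      using has_sum_imp_sums[OF has_sum_infsum[OF col]] l sums_unique2 by blast
    have "l summable_on UNIV"
      using summable_on_Sigma_banach[of "\<lambda>m n. f n m" UNIV "\<lambda>_. UNIV"] sum' by (simp add: c)
    hence "l sums infsum l UNIV" by (rule has_sum_imp_sums[OF has_sum_infsum])
    moreover have "infsum l UNIV = infsum (\<lambda>n. \<Sum>m. f n m) UNIV"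
      using infsum_swap_banach[OF sum] by (simp add: c r)
    moreover have "infsum (\<lambda>n. \<Sum>m. f n m) UNIV = (\<Sum>n. \<Sum>m. f n m)"
      using has_sum_imp_sums[OF has_sum_infsum[OF rows]] sums_unique by blast
    ultimately show ?thesis by (simp add: sums_iff)
  qed
qed

section \<open>Quadratic exponents and Gaussian weights in the index difference\<close>

lemma choose_2_add: "(m + d choose 2) = (m choose 2) + (d choose 2) + m * d"
  by (induction d) (simp_all add: choose_2_Suc numeral_2_eq_2)

lemma square_eq_choose_2: "m * m = 2 * (m choose 2) + m"
  by (induction m) (simp_all add: choose_2_Suc numeral_2_eq_2)

text \<open>Trades a base depending on \<open>n\<close> for a fixed one; this is the source of
  \<open>1 / (u * x * t)\<close> and \<open>1 / (v * x * t)\<close> in the theorem.\<close>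

lemma qpoch_reverse:
  assumes "q \<noteq> 0" "b \<noteq> 0"
  shows "qpoch (b * q / q ^ n) q n = qpoch (1 / b) q n * (- b) ^ n / q ^ (n choose 2)"
proof -
  have "(1 / b) ^ n * qpoch (q / q ^ n / (1 / b)) q n = (\<Prod>j<n. 1 / b - 1 / q ^ j)"
    using assms by (intro prod_diff_inverse_power[symmetric]) auto
  also have "\<dots> = (- 1) ^ n * qpoch (1 / b) q n / q ^ (n choose 2)"
    using assms by (induction n) (simp_all add: qpoch_Suc choose_2_Suc power_add field_simps numeral_2_eq_2)
  finally have eq: "(1 / b) ^ n * qpoch (q / q ^ n / (1 / b)) q n = (- 1) ^ n * qpoch (1 / b) q n / q ^ (n choose 2)" .
  have "qpoch (b * q / q ^ n) q n = b ^ n * ((1 / b) ^ n * qpoch (q / q ^ n / (1 / b)) q n)"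
    using assms by (simp add: power_divide mult.commute)
  also have "\<dots> = qpoch (1 / b) q n * (- b) ^ n / q ^ (n choose 2)"
    unfolding eq by (simp add: power_minus[of b])
  finally show ?thesis .
qed

text \<open>The two-sided Gaussian \<open>A^d Q^(d(d+1)/2)\<close> over all integers
  \<open>d\<close>, in two branches so that every exponent is a natural number.\<close>

definition diff_weight :: "real \<Rightarrow> real \<Rightarrow> int \<Rightarrow> real" where
  "diff_weight A Q d = (if d \<ge> 0 then A ^ nat d * Q ^ (Suc (nat d) choose 2)
     else (1 / A) ^ nat (- d) * Q ^ (nat (- d) choose 2))"

text \<open>On each half-line \<open>|d|\<close> is at most \<open>2^|d|\<close>, which is absorbed
  by doubling the base \<open>A\<close> or \<open>1 / A\<close> of a one-sided Gaussian
  series.\<close>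

lemma summable_on_diff_weight:
  assumes "A > 0" "0 < Q" "Q < 1"
  shows "(\<lambda>d. \<bar>of_int d\<bar> * diff_weight A Q d) summable_on UNIV"
proof -
  have k: "real k \<le> 2 ^ k" for k
    by (rule less_imp_le[OF of_nat_less_two_power])
  have sum: "summable (\<lambda>k. (2 * B) ^ k * Q ^ (k choose 2))" for B
    using assms by (intro summable_power_times_gauss) auto
  have le: "real k * (B ^ k * Q ^ e) \<le> (2 * B) ^ k * Q ^ (k choose 2)"
    if "B > 0" "e \<ge> (k choose 2)" for B k e
  proof -
    have "real k * (B ^ k * Q ^ e) \<le> 2 ^ k * (B ^ k * Q ^ (k choose 2))"
      using that assms by (intro mult_mono k power_decreasing order.refl) auto
    thus ?thesis by (simp add: power_mult_distrib)
  qed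
  have "(\<lambda>k. real k * (A ^ k * Q ^ (Suc k choose 2))) summable_on UNIV"
  proof (rule norm_summable_imp_summable_on, rule summable_comparison_test'[OF sum[of A]])
    fix k
    show "norm (norm (real k * (A ^ k * Q ^ (Suc k choose 2)))) \<le> (2 * A) ^ k * Q ^ (k choose 2)"
      using le[of A k "Suc k choose 2"] assms by (simp add: choose_2_Suc)
  qed
  hence pos: "(\<lambda>d. \<bar>of_int d\<bar> * diff_weight A Q d) summable_on range int"
    by (subst summable_on_reindex) (auto simp: o_def diff_weight_def)
  have "(\<lambda>k. real (Suc k) * ((1 / A) ^ Suc k * Q ^ (Suc k choose 2))) summable_on UNIV"
  proof -
    have "summable (\<lambda>k. (2 * (1 / A)) ^ Suc k * Q ^ (Suc k choose 2))"
      using sum[of "1 / A"] by (subst summable_Suc_iff)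
    thus ?thesis
    proof (intro norm_summable_imp_summable_on, elim summable_comparison_test')
      fix k
      show "norm (norm (real (Suc k) * ((1 / A) ^ Suc k * Q ^ (Suc k choose 2)))) \<le> (2 * (1 / A)) ^ Suc k * Q ^ (Suc k choose 2)"
        using le[of "1 / A" "Suc k" "Suc k choose 2"] assms
        by (simp del: power_Suc of_nat_Suc)
    qed
  qed
  hence neg: "(\<lambda>d. \<bar>of_int d\<bar> * diff_weight A Q d) summable_on range (\<lambda>k. - int (Suc k))"
    by (subst summable_on_reindex)
       (auto simp: o_def diff_weight_def inj_on_def simp del: power_Suc of_nat_Suc)
  have "range int \<inter> range (\<lambda>k. - int (Suc k)) = {}" by auto
  moreover have "range int \<union> range (\<lambda>k. - int (Suc k)) = UNIV"
  proof -
    have "d \<in> range int \<union> range (\<lambda>k. - int (Suc k))" for d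
    proof (cases "d \<ge> 0")
      case True
      hence "d = int (nat d)" by simp
      thus ?thesis by blast
    next
      case False
      hence "d = - int (Suc (nat (- d - 1)))" by simp
      thus ?thesis by blast
    qed
    thus ?thesis by blast
  qed
  ultimately show ?thesis
    using summable_on_Un_disjoint[OF pos neg] by simp
qed

text \<open>Completing the square: for \<open>d = n - m\<close>, the exponent
  \<open>n(n+1)/2 - nm\<close> equals \<open>d(d+1)/2 - m(m-1)/2\<close>.\<close>

lemma gauss_weight_eq_diff_weight:
  assumes "A > 0" "0 < Q"
  shows "Q ^ (n choose 2) * (A * Q) ^ n * (f * (t / Q ^ n) ^ m)
    = f * (A * t) ^ m / Q ^ (m choose 2) * diff_weight A Q (int n - int m)"
proof (cases "m \<le> n")
  case True
  then obtain d where n: "n = m + d" using le_Suc_ex by blast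
  have "(Q ^ n) ^ m = Q ^ (2 * (m choose 2) + m + d * m)"
    unfolding power_mult[symmetric] n by (simp add: add_mult_distrib square_eq_choose_2)
  thus ?thesis
    using assms unfolding power_divide n diff_weight_def
    by (simp add: choose_2_add choose_2_Suc power_add power_mult_distrib field_simps power2_eq_square mult_2)
next
  case False
  then obtain d where m: "m = n + d" and d: "d > 0" using less_imp_add_positive not_le by metis
  have "(Q ^ n) ^ m = Q ^ (2 * (n choose 2) + n + n * d)"
    unfolding power_mult[symmetric] m by (simp add: distrib_left square_eq_choose_2)
  thus ?thesis
    using assms d unfolding power_divide m diff_weight_def
    by (simp add: choose_2_add power_add power_mult_distrib field_simps power2_eq_square mult_2)
qed

text \<open>The summand is \<open>w m * diff_weight (n - m)\<close> up to bounded factors. Its diagonal shows that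
  \<open>w\<close> is summable, and the Gaussian decay of \<open>diff_weight\<close> absorbs the extra factor \<open>m - n\<close>.\<close>

lemma summable_on_index_difference:
  fixes q \<alpha> \<tau> :: complex and s F :: "nat \<Rightarrow> complex"
  assumes q: "0 < norm q" "norm q < 1" and nz: "\<alpha> \<noteq> 0"
    and c: "c > 0" "\<And>n. c * (norm q ^ (n choose 2) * norm (\<alpha> * q) ^ n) \<le> norm (s n)"
    and C: "\<And>n. norm (s n) \<le> C * (norm q ^ (n choose 2) * norm (\<alpha> * q) ^ n)"
    and sum: "(\<lambda>(n, m). norm (s n * (F m * (\<tau> / q ^ n) ^ m))) summable_on UNIV"
  shows "(\<lambda>(n, m). norm (s n * ((of_nat m - of_nat n) * F m * (\<tau> / q ^ n) ^ m))) summable_on UNIV"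
proof -
  define w where "w m = norm (F m) * (norm \<alpha> * norm \<tau>) ^ m / norm q ^ (m choose 2)" for m
  define b where "b d = \<bar>of_int d\<bar> * diff_weight (norm \<alpha>) (norm q) d" for d
  have A: "norm \<alpha> > 0" using nz by simp
  have w0: "w m \<ge> 0" for m by (simp add: w_def)
  have dw: "diff_weight (norm \<alpha>) (norm q) d \<ge> 0" for d by (simp add: diff_weight_def)
  have key: "norm q ^ (n choose 2) * norm (\<alpha> * q) ^ n * norm (F m * (\<tau> / q ^ n) ^ m)
      = w m * diff_weight (norm \<alpha>) (norm q) (int n - int m)" for n m
    using gauss_weight_eq_diff_weight[OF A q(1), of n "norm (F m)" "norm \<tau>" m]
    by (simp add: norm_mult norm_power norm_divide w_def)
  have "(\<lambda>(n, m). norm (s n * (F m * (\<tau> / q ^ n) ^ m))) summable_on range (\<lambda>m. (m, m))"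
    by (rule summable_on_subset_banach[OF sum]) simp
  hence diag: "summable (\<lambda>m. norm (s m * (F m * (\<tau> / q ^ m) ^ m)))"
    by (subst (asm) summable_on_reindex) (auto simp: inj_on_def o_def intro: summable_on_imp_summable)
  have "summable w"
  proof (rule summable_comparison_test'[OF summable_mult[OF diag, of "1 / c"]])
    fix m
    have "c * w m = c * (norm q ^ (m choose 2) * norm (\<alpha> * q) ^ m) * norm (F m * (\<tau> / q ^ m) ^ m)"
      using key[of m m] by (simp add: diff_weight_def mult.assoc numeral_2_eq_2)
    also have "\<dots> \<le> norm (s m) * norm (F m * (\<tau> / q ^ m) ^ m)"
      by (intro mult_right_mono c) auto
    finally show "norm (w m) \<le> 1 / c * norm (s m * (F m * (\<tau> / q ^ m) ^ m))"
      using c(1) w0[of m] by (simp only: real_norm_def abs_of_nonneg norm_mult) (simp add: field_simps)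
  qed
  hence w: "w summable_on UNIV"
    using w0 by (simp add: summable_on_UNIV_nonneg_real_iff)
  have b: "b summable_on UNIV"
    unfolding b_def using summable_on_diff_weight[OF A q] .
  have b0: "b d \<ge> 0" for d by (simp add: b_def dw)
  have "(\<lambda>p. norm (case p of (m, d) \<Rightarrow> w m * b d)) summable_on UNIV \<times> UNIV"
  proof (rule iffD2[OF Infinite_Sum.abs_summable_on_Sigma_iff], intro conjI ballI)
    have nn: "norm (w m * b d) = w m * b d" for m d using w0 b0 by simp
    show "(\<lambda>d. norm (case (m, d) of (m, d) \<Rightarrow> w m * b d)) summable_on UNIV" for m
      unfolding prod.case nn by (rule summable_on_cmult_right[OF b])
    have "norm (w m * infsum b UNIV) = w m * infsum b UNIV" for m
      using w0 b0 by (simp add: infsum_nonneg)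
    thus "(\<lambda>m. norm (infsum (\<lambda>d. norm (case (m, d) of (m, d) \<Rightarrow> w m * b d)) UNIV)) summable_on UNIV"
      unfolding prod.case nn infsum_cmult_right' using summable_on_cmult_left[OF w] by (simp only:)
  qed
  \<comment> \<open>As \<open>(n, m)\<close> determines and is determined by
    \<open>(m, n - m)\<close>, the double series is a subfamily of a product family.\<close>
  hence "(\<lambda>(m, d). w m * b d) summable_on range (\<lambda>(n, m). (m, int n - int m))"
    by (rule summable_on_subset_banach[OF abs_summable_summable]) simp
  hence "(\<lambda>(n, m). w m * b (int n - int m)) summable_on UNIV"
    by (subst (asm) summable_on_reindex) (auto simp: inj_on_def o_def case_prod_unfold)
  hence "(\<lambda>p. C * (case p of (n, m) \<Rightarrow> w m * b (int n - int m))) summable_on UNIV"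
    by (rule summable_on_cmult_right)
  hence "(\<lambda>p. norm (case p of (n, m) \<Rightarrow> s n * ((of_nat m - of_nat n) * F m * (\<tau> / q ^ n) ^ m))) summable_on UNIV"
  proof (rule Infinite_Sum.abs_summable_on_comparison_test')
    fix p :: "nat \<times> nat"
    obtain n m where p: "p = (n, m)" by (cases p)
    have d: "norm (of_nat m - of_nat n :: complex) = \<bar>of_int (int n - int m)\<bar>"
      by (metis (no_types) abs_minus_commute norm_of_int of_int_diff of_int_of_nat_eq norm_minus_commute)
    have "norm (s n * ((of_nat m - of_nat n) * F m * (\<tau> / q ^ n) ^ m))
        = norm (s n) * (\<bar>of_int (int n - int m)\<bar> * norm (F m * (\<tau> / q ^ n) ^ m))"
      by (simp only: norm_mult d mult.assoc)
    also have "\<dots> \<le> C * (norm q ^ (n choose 2) * norm (\<alpha> * q) ^ n) * (\<bar>of_int (int n - int m)\<bar> * norm (F m * (\<tau> / q ^ n) ^ m))"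
      by (intro mult_right_mono C) auto
    also have "\<dots> = C * \<bar>of_int (int n - int m)\<bar> * (norm q ^ (n choose 2) * norm (\<alpha> * q) ^ n * norm (F m * (\<tau> / q ^ n) ^ m))"
      by (simp only: mult_ac)
    also have "\<dots> = C * (w m * b (int n - int m))"
      unfolding key b_def by (simp only: mult_ac)
    finally show "norm (case p of (n, m) \<Rightarrow> s n * ((of_nat m - of_nat n) * F m * (\<tau> / q ^ n) ^ m))
        \<le> C * (case p of (n, m) \<Rightarrow> w m * b (int n - int m))"
      by (simp add: p)
  qed
  thus ?thesis by (simp add: case_prod_unfold)
qed

section \<open>The bilinear generating function\<close>

lemma qpochs_Cons [simp]: "qpochs (c # cs) q n = qpoch c q n * qpochs cs q n"
  and qpochs_Nil [simp]: "qpochs [] q n = 1"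
  by (simp_all add: qpochs_def)

text \<open>The moduli of \<open>\<tau> / q ^ n\<close> are unbounded, so convergence along this
  sequence forces an infinite radius of convergence.\<close>

lemma powser_summable_everywhere:
  fixes c :: "nat \<Rightarrow> complex" and q \<tau> :: complex
  assumes q: "0 < norm q" "norm q < 1" and "\<tau> \<noteq> 0"
    and c: "\<And>n. summable (\<lambda>k. c k * (\<tau> / q ^ n) ^ k)"
  shows "summable (\<lambda>k. norm (c k * w ^ k))"
proof -
  obtain n where n: "norm q ^ n < norm \<tau> / (norm w + 1)"
    using real_arch_pow_inv[of "norm \<tau> / (norm w + 1)" "norm q"] assms
    by (auto simp: add_nonneg_pos)
  have "norm w < norm w + 1" by simp
  moreover have "0 < norm w + 1" by (simp add: add_nonneg_pos)
  moreover from this have "norm w + 1 < norm (\<tau> / q ^ n)"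
    using n q by (simp add: norm_divide norm_power less_divide_eq mult.commute)
  ultimately have "norm w < norm (\<tau> / q ^ n)" by linarith
  thus ?thesis by (rule powser_insidea[OF c])
qed

text \<open>Where \<open>(u T; q)\<close> has a simple zero, comparing derivatives in the generating function
  identity recovers the value of the hypergeometric series.\<close>

lemma gen_hyp_coeff_derivative_at_zero:
  fixes q u v z \<tau> :: complex
  assumes q: "0 < norm q" "norm q < 1"
    and F: "\<And>n. summable (\<lambda>m. norm (gen_hyp_coeff as bs u v z q m * (\<tau> / q ^ n) ^ m))"
    and Phi: "\<And>n. summable (basic_hyp_term as bs q (z * (\<tau> / q ^ n)))"
    and zero: "u * \<tau> * q ^ i = 1"
    and v: "qpoch_inf (v * (\<tau> / q ^ n)) q \<noteq> 0"
  defines "T \<equiv> \<tau> / q ^ n"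
  shows "(\<Sum>m. gen_hyp_coeff as bs u v z q m * T ^ m) = 0"
    and "summable (\<lambda>m. of_nat m * gen_hyp_coeff as bs u v z q m * T ^ m)"
    and "(\<Sum>m. of_nat m * gen_hyp_coeff as bs u v z q m * T ^ m) * qpoch_inf (v * T) q
       = - (qpoch (u * T) q (n + i) * qpoch_inf q q * basic_hyp as bs q (z * T))"
proof -
  let ?F = "gen_hyp_coeff as bs u v z q"
  let ?f = "\<lambda>w. \<Sum>m. ?F m * w ^ m"
  let ?d = "\<Sum>m. diffs ?F m * T ^ m"
  have q0: "q \<noteq> 0" using q by auto
  have \<tau>0: "\<tau> \<noteq> 0" using zero by auto
  have T0: "T \<noteq> 0" using q0 \<tau>0 by (simp add: T_def)
  have Fw: "summable (\<lambda>m. norm (?F m * w ^ m))" for w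
    by (rule powser_summable_everywhere[OF q \<tau>0 summable_norm_cancel[OF F]])
  have hyp_term: "basic_hyp_term as bs q (z * w) = (\<lambda>k. (hyp_coeff as bs q k * z ^ k) * w ^ k)" for w
    by (rule ext) (simp add: basic_hyp_term_eq power_mult_distrib)
  have Phiw: "summable (\<lambda>k. norm ((hyp_coeff as bs q k * z ^ k) * w ^ k))" for w
    by (rule powser_summable_everywhere[OF q \<tau>0 Phi[unfolded hyp_term]])
  have hyp: "basic_hyp as bs q (z * w) = (\<Sum>k. (hyp_coeff as bs q k * z ^ k) * w ^ k)" for w
    by (simp only: basic_hyp_def hyp_term)
  have gf: "?f w * qpoch_inf (v * w) q = qpoch_inf (u * w) q * basic_hyp as bs q (z * w)" for w
  proof (rule gen_hyp_coeff_generating_function[OF q(2) q0 Fw])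
    show "summable (basic_hyp_term as bs q (z * w))"
      unfolding hyp_term by (rule summable_norm_cancel[OF Phiw])
  qed
  \<comment> \<open>Dividing \<open>\<tau>\<close> by \<open>q ^ n\<close> moves the vanishing
    factor from position \<open>i\<close> to position \<open>n + i\<close>.\<close>
  have uT: "u * T * q ^ (n + i) = 1"
    using zero q0 by (simp add: T_def power_add mult.assoc)
  \<comment> \<open>The vanishing factor is isolated as \<open>1 - w / T\<close>; the tail behind it
    becomes \<open>qpoch_inf q q\<close> at \<open>w = T\<close>.\<close>
  have uw: "qpoch_inf (u * w) q = qpoch (u * w) q (n + i) * (1 - w / T) * qpoch_inf (w / T * q) q" for w
  proof -
    have "u * w * q ^ (n + i) = w / T"
      using uT T0 by (simp add: field_simps)
    thus ?thesis
      using qpoch_inf_split[OF q(2), of "u * w" "Suc (n + i)"]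
      by (simp add: qpoch_Suc mult.commute mult.left_commute)
  qed
  show f0: "?f T = 0"
    using gf[of T] uw[of T] v T0 by (simp add: T_def[symmetric])
  have deriv: "(?f has_field_derivative ?d) (at T)"
    by (rule termdiffs_strong_converges_everywhere[OF summable_norm_cancel[OF Fw]])
  have "(\<lambda>m. of_nat m * ?F m * T ^ (m - Suc 0)) sums ?d"
    by (rule diffs_equiv[OF termdiff_converges_all[OF summable_norm_cancel[OF Fw]]])
  hence "(\<lambda>m. T * (of_nat m * ?F m * T ^ (m - Suc 0))) sums (T * ?d)"
    by (rule sums_mult)
  moreover have "T * (of_nat m * ?F m * T ^ (m - Suc 0)) = of_nat m * ?F m * T ^ m" for m
    by (cases m) auto
  ultimately have sums: "(\<lambda>m. of_nat m * ?F m * T ^ m) sums (T * ?d)" by simp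
  thus "summable (\<lambda>m. of_nat m * ?F m * T ^ m)" by (rule sums_summable)
  have cont: "isCont (\<lambda>w. qpoch_inf (c * w) q) w" for c w
    by (rule isCont_o2[OF _ isCont_qpoch_inf[OF q(2)]]) (intro continuous_intros)
  \<comment> \<open>The identity \<open>gf\<close> divided by \<open>w - T\<close> has two limits at
    \<open>T\<close>: a derivative on the left, since \<open>?f T = 0\<close>, and a value by
    continuity on the right.\<close>
  have lim1: "((\<lambda>w. (?f w - ?f T) / (w - T) * qpoch_inf (v * w) q) \<longlongrightarrow> ?d * qpoch_inf (v * T) q) (at T)"
    using deriv cont by (intro tendsto_mult) (auto simp: has_field_derivative_iff isCont_def)
  have lim2: "((\<lambda>w. qpoch (u * w) q (n + i) * (- 1 / T) * qpoch_inf (q / T * w) q * basic_hyp as bs q (z * w))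
      \<longlongrightarrow> qpoch (u * T) q (n + i) * (- 1 / T) * qpoch_inf (q / T * T) q * basic_hyp as bs q (z * T)) (at T)"
  proof (intro tendsto_mult tendsto_const isContD)
    show "isCont (\<lambda>w. qpoch (u * w) q (n + i)) T"
      unfolding qpoch_def by (intro continuous_intros)
    show "isCont (\<lambda>w. qpoch_inf (q / T * w) q) T" by (rule cont)
    show "isCont (\<lambda>w. basic_hyp as bs q (z * w)) T"
      unfolding hyp by (rule isCont_powser_converges_everywhere[OF summable_norm_cancel[OF Phiw]])
  qed
  have ev: "eventually (\<lambda>w. (?f w - ?f T) / (w - T) * qpoch_inf (v * w) q
      = qpoch (u * w) q (n + i) * (- 1 / T) * qpoch_inf (q / T * w) q * basic_hyp as bs q (z * w)) (at T)"
  proof (rule eventually_at_filter[THEN iffD2], intro always_eventually allI impI)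
    fix w assume "w \<noteq> T"
    hence "(1 - w / T) / (w - T) = - 1 / T" using T0 by (simp add: field_simps)
    moreover have "(?f w - ?f T) / (w - T) * qpoch_inf (v * w) q
      = (?f w * qpoch_inf (v * w) q) / (w - T)"
      unfolding f0 by simp
    moreover have "\<dots> = qpoch (u * w) q (n + i) * ((1 - w / T) / (w - T)) * qpoch_inf (q / T * w) q * basic_hyp as bs q (z * w)"
      unfolding gf uw by (simp add: mult_ac)
    ultimately show "(?f w - ?f T) / (w - T) * qpoch_inf (v * w) q
      = qpoch (u * w) q (n + i) * (- 1 / T) * qpoch_inf (q / T * w) q * basic_hyp as bs q (z * w)"
      by simp
  qed
  have "?d * qpoch_inf (v * T) q
      = qpoch (u * T) q (n + i) * (- 1 / T) * qpoch_inf (q / T * T) q * basic_hyp as bs q (z * T)"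
    by (rule tendsto_unique[OF at_neq_bot Lim_transform_eventually[OF lim1 ev] lim2])
  hence "T * ?d * qpoch_inf (v * T) q = - (qpoch (u * T) q (n + i) * qpoch_inf q q * basic_hyp as bs q (z * T))"
    using T0 by (simp add: field_simps)
  thus "(\<Sum>m. of_nat m * ?F m * T ^ m) * qpoch_inf (v * T) q
       = - (qpoch (u * T) q (n + i) * qpoch_inf q q * basic_hyp as bs q (z * T))"
    using sums_unique[OF sums] by simp
qed

theorem theorem3:
  fixes q \<alpha> x t u v z :: complex and as bs :: "complex list"
  assumes q: "0 < norm q" "norm q < 1"
    and bound: "Max {norm (\<alpha> * q), norm (v * x * t * q), norm (x * z * t * q)} < 1"
    and nonzero: "\<alpha> \<noteq> 0" "x \<noteq> 0" "t \<noteq> 0" "u \<noteq> 0" "v \<noteq> 0"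
    and denom: "\<And>k. qpochs bs q k \<noteq> 0"
      "\<And>n. qpochs [q / x, 1 / (v * x * t), q] q n \<noteq> 0"
    and conv_Phi: "\<And>n. qpoch (1 / (\<alpha> * x)) q n \<noteq> 0 \<Longrightarrow>
      summable (basic_hyp_term as bs q (x * z * t * q powi (1 - int n)))"
    and conv_double: "(\<lambda>(n, m). norm (
        (-1) ^ n * q ^ (n choose 2) * qpoch (1 / (\<alpha> * x)) q n / qpochs [q / x, q] q n
          * (\<alpha> * q) ^ n
          * (gen_hyp_poly as bs m u v z q * (-1) ^ m * q ^ (m choose 2)
              * (x * t * q powi (1 - int n)) ^ m / qpoch q q m)))
        summable_on (UNIV :: (nat \<times> nat) set)"
  defines "L \<equiv> \<lambda>n. al_salam_carlitz \<alpha> n x q * gen_hyp_poly as bs n u v z q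
        * ((-1) ^ n * q ^ ((n + 1) choose 2) * t ^ n / qpoch q q n)"
    and "R \<equiv> \<lambda>n. (-1) ^ n * q ^ (n choose 2) * qpochs [1 / (\<alpha> * x), 1 / (u * x * t)] q n
        / qpochs [q / x, 1 / (v * x * t), q] q n
        * (\<alpha> * u * q / v) ^ n
        * basic_hyp as bs q (x * z * t * q powi (1 - int n))"
  shows "summable L \<and> summable R \<and>
    (\<Sum>n. L n) =
      qpochs_inf [q / x, u * x * t * q] q / qpochs_inf [\<alpha> * q, v * x * t * q] q * (\<Sum>n. R n)"
proof -
  have q0: "q \<noteq> 0" using q by auto
  have aq: "norm (\<alpha> * q) < 1" and vq: "norm (v * x * t * q) < 1"
    using bound by auto
  define \<tau> where "\<tau> = x * t * q"
  define T where "T n = \<tau> / q ^ n" for n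
  define F where "F = gen_hyp_coeff as bs u v z q"
  define s where "s n = (-1) ^ n * q ^ (n choose 2) * qpoch (1 / (\<alpha> * x)) q n / qpochs [q / x, q] q n * (\<alpha> * q) ^ n" for n
  define U where "U = qpoch_inf (u * \<tau>) q"
  define V where "V = qpoch_inf (v * \<tau>) q"
  define K where "K = qpoch_inf (q / x) q / qpoch_inf (\<alpha> * q) q"
  define B where "B n = basic_hyp as bs q (z * T n)" for n
  have \<tau>0: "\<tau> \<noteq> 0" using nonzero q0 by (simp add: \<tau>_def)
  have vt: "norm (v * \<tau>) < 1" using vq by (simp add: \<tau>_def mult_ac)
  have V0: "V \<noteq> 0" unfolding V_def by (rule qpoch_inf_nonzero[OF q(2) vt])
  have A0: "qpoch_inf (\<alpha> * q) q \<noteq> 0" by (rule qpoch_inf_nonzero[OF q(2) aq])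
  have qx: "qpoch (q / x) q n \<noteq> 0" and vx: "qpoch (1 / (v * x * t)) q n \<noteq> 0" and qq: "qpoch q q n \<noteq> 0" for n
    using denom(2)[of n] by auto
  have T_powi: "x * t * q powi (1 - int n) = T n" for n
    using q0 by (simp add: T_def \<tau>_def power_int_diff)
  have z_powi: "x * z * t * q powi (1 - int n) = z * T n" for n
    using T_powi[of n] by (simp add: mult_ac)
  \<comment> \<open>Convergence of the inner series is known only in rows with \<open>s n\<close>
    nonzero; in the other rows both sides vanish.\<close>
  have s0: "s n = 0 \<longleftrightarrow> qpoch (1 / (\<alpha> * x)) q n = 0" for n
    using qx qq q0 nonzero by (simp add: s_def)
  have D: "(\<lambda>(n, m). norm (s n * (F m * T n ^ m))) summable_on UNIV"
    using conv_double unfolding T_powi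
    by (simp add: s_def F_def gen_hyp_coeff_def case_prod_unfold)
  have Fsum: "summable (\<lambda>m. norm (F m * T n ^ m))" if "s n \<noteq> 0" for n
  proof -
    have "summable (\<lambda>m. norm (s n) * norm (F m * T n ^ m))"
      using abs_double_sum_row[OF D, of n] by (simp only: norm_mult)
    from summable_mult[OF this, of "1 / norm (s n)"] that show ?thesis by simp
  qed
  have Psum: "summable (basic_hyp_term as bs q (z * T n))" if "s n \<noteq> 0" for n
    using conv_Phi[of n] that unfolding z_powi s0 by blast
  have split: "qpoch_inf (c * T n) q = qpoch (c * T n) q n * qpoch_inf (c * \<tau>) q" for c n
    using qpoch_inf_split[OF q(2), of "c * T n" n] q0 by (simp add: T_def)
  have rev: "qpoch (c * T n) q n = qpoch (1 / (c * x * t)) q n * (- (c * x * t)) ^ n / q ^ (n choose 2)" if "c \<noteq> 0" for c n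
    using qpoch_reverse[OF q0, of "c * x * t" n] that nonzero by (simp add: T_def \<tau>_def mult_ac)
  have vT0: "qpoch (v * T n) q n \<noteq> 0" for n
    using vx nonzero q0 by (simp add: rev)
  \<comment> \<open>After both symbols are reversed the Gaussian powers of \<open>q\<close> cancel,
    and the remaining powers account for \<open>(u / v) ^ n\<close>.\<close>
  have R_eq: "R n = s n * qpoch (u * T n) q n / qpoch (v * T n) q n * B n" for n
  proof -
    have "(\<alpha> * u * q / v) ^ n = (\<alpha> * q) ^ n * (- (u * x * t)) ^ n / (- (v * x * t)) ^ n"
      unfolding power_mult_distrib[symmetric] power_divide[symmetric] using nonzero by (simp add: field_simps)
    thus ?thesis
      unfolding R_def z_powi B_def rev[OF nonzero(4)] rev[OF nonzero(5)] s_def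
      using q0 by (simp add: mult_ac)
  qed
  have gf: "s n * (\<Sum>m. F m * T n ^ m) = U / V * R n" for n
  proof (cases "s n = 0")
    case False
    have "(\<Sum>m. F m * T n ^ m) * (qpoch (v * T n) q n * V) = qpoch (u * T n) q n * U * B n"
      using gen_hyp_coeff_generating_function[OF q(2) q0 Fsum[OF False, unfolded F_def] Psum[OF False]]
      by (simp only: split F_def U_def V_def B_def)
    thus ?thesis
      using V0 vT0[of n] by (simp add: R_eq field_simps)
  qed (simp add: R_eq)
  have row: "(\<Sum>m. K * (s n * (F m * T n ^ m))) = K * U / V * R n" for n
  proof (cases "s n = 0")
    case False
    have "(\<Sum>m. K * (s n * (F m * T n ^ m))) = K * (s n * (\<Sum>m. F m * T n ^ m))"
      using summable_norm_cancel[OF Fsum[OF False]] by (simp add: suminf_mult summable_mult)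
    thus ?thesis by (simp add: gf)
  qed (simp add: R_eq)
  \<comment> \<open>The product in \<open>K\<close> over the finite symbol in \<open>s n\<close> is
    \<open>qpoch_inf (q / x * q ^ n) q\<close>, as in the Al-Salam--Carlitz series.\<close>
  have col: "(\<lambda>n. K * (s n * (F m * T n ^ m))) sums L m" for m
  proof -
    have "(-1) ^ n * q ^ (n choose 2) * qpoch (1 / (\<alpha> * x)) q n / qpoch q q n * (\<alpha> * q) ^ n
             * qpoch_inf (q / x * q ^ n) q * (x / q ^ n) ^ m = qpoch_inf (q / x) q * s n * (x / q ^ n) ^ m" for n
      using qx[of n] qpoch_inf_split[OF q(2), of "q / x" n] by (simp add: s_def)
    hence "(\<lambda>n. qpoch_inf (q / x) q * s n * (x / q ^ n) ^ m) sums (qpoch_inf (\<alpha> * q) q * al_salam_carlitz \<alpha> m x q)"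
      using al_salam_carlitz_sums[OF q nonzero(1,2), of m] by (simp only:)
    from sums_mult[OF this, of "F m * (t * q) ^ m / qpoch_inf (\<alpha> * q) q"]
    have "(\<lambda>n. F m * (t * q) ^ m / qpoch_inf (\<alpha> * q) q * (qpoch_inf (q / x) q * s n * (x / q ^ n) ^ m))
        sums (F m * (t * q) ^ m * al_salam_carlitz \<alpha> m x q)"
      using A0 by (simp add: mult.assoc)
    moreover have "F m * (t * q) ^ m / qpoch_inf (\<alpha> * q) q * (qpoch_inf (q / x) q * s n * (x / q ^ n) ^ m)
        = K * (s n * (F m * T n ^ m))" for n
    proof -
      have "T n ^ m = (t * q) ^ m * (x / q ^ n) ^ m"
        unfolding power_mult_distrib[symmetric] T_def \<tau>_def by (simp add: mult_ac)
      thus ?thesis by (simp add: K_def)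
    qed
    moreover have "F m * (t * q) ^ m * al_salam_carlitz \<alpha> m x q = L m"
      by (simp add: L_def F_def gen_hyp_coeff_def choose_2_Suc power_add power_mult_distrib)
    ultimately show ?thesis by simp
  qed
  have "(\<lambda>(n, m). norm (K * (s n * (F m * T n ^ m)))) summable_on UNIV"
    using summable_on_cmult_right[OF D, of "norm K"] by (simp add: norm_mult case_prod_unfold)
  from abs_double_sum_swap[OF this col]
  have L: "summable L" "(\<Sum>n. L n) = (\<Sum>n. K * U / V * R n)"
    by (simp_all add: row)
  have R: "summable R"
  proof (cases "U = 0")
    case False
    have "(\<Sum>m. s n * (F m * T n ^ m)) = U / V * R n" for n
    proof (cases "s n = 0")
      case nz: False
      show ?thesis
        using suminf_mult[OF summable_norm_cancel[OF Fsum[OF nz]], of "s n"] by (simp add: gf)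
    qed (simp add: R_eq)
    hence "summable (\<lambda>n. U / V * R n)"
      using abs_double_sum_rows[OF D] by simp
    from summable_mult[OF this, of "V / U"] show ?thesis
      using False V0 by simp
  next
    case True
    then obtain i where i: "u * \<tau> * q ^ i = 1"
      unfolding U_def qpoch_inf_eq_0_iff[OF q(2)] by blast
    show ?thesis
    proof (cases "\<exists>N. qpoch (1 / (\<alpha> * x)) q N = 0")
      case True
      then obtain N where "qpoch (1 / (\<alpha> * x)) q N = 0" by blast
      hence "R n = 0" if "n \<notin> {..<N}" for n
        using qpoch_eq_0_mono[of "1 / (\<alpha> * x)" q N n] that by (simp add: R_eq s0)
      thus ?thesis by (intro summable_finite[of "{..<N}"]) auto
    next
      case False
      hence snz: "s n \<noteq> 0" for n by (simp add: s0)
      \<comment> \<open>The constant, free of \<open>n\<close>, obtained by solving the derivative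
        identity for \<open>R n\<close>.\<close>
      define \<kappa> where "\<kappa> = - (V / (qpoch (u * \<tau>) q i * qpoch_inf q q))"
      \<comment> \<open>Two-sided bounds make \<open>norm (s n)\<close> comparable to its Gaussian
        part; the lower one uses that, in this case, \<open>qpoch (1 / (\<alpha> * x)) q n\<close>
        never vanishes.\<close>
      obtain C where C: "C > 0" "\<And>n. norm (qpoch (1 / (\<alpha> * x)) q n) \<le> C" "\<And>n. norm (qpoch (q / x) q n) \<le> C"
          "\<And>n. norm (qpoch q q n) \<le> C"
        using qpoch_uniform_bound[OF q(2), of "norm (1 / (\<alpha> * x)) + norm (q / x) + norm q"]
        by (metis add_increasing add_increasing2 add_nonneg_nonneg norm_ge_zero order.refl)
      obtain a where a: "a > 0" "\<And>n. a \<le> norm (qpoch (1 / (\<alpha> * x)) q n)"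
        using qpoch_bounded_below[OF q(2)] False by metis
      obtain b where b: "b > 0" "\<And>n. b \<le> norm (qpoch (q / x) q n)"
        using qpoch_bounded_below[OF q(2) qx] by blast
      obtain d where d: "d > 0" "\<And>n. d \<le> norm (qpoch q q n)"
        using qpoch_bounded_below[OF q(2) qq] by blast
      have ns: "norm (s n) = norm (qpoch (1 / (\<alpha> * x)) q n) / (norm (qpoch (q / x) q n) * norm (qpoch q q n))
          * (norm q ^ (n choose 2) * norm (\<alpha> * q) ^ n)" for n
        by (simp add: s_def norm_mult norm_divide norm_power)
      have "(\<lambda>(n, m). norm (s n * ((of_nat m - of_nat n) * F m * (\<tau> / q ^ n) ^ m))) summable_on UNIV"
      proof (rule summable_on_index_difference[OF q nonzero(1)])
        show "a / (C * C) > 0" using a(1) C(1) by simp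
        show "a / (C * C) * (norm q ^ (n choose 2) * norm (\<alpha> * q) ^ n) \<le> norm (s n)" for n
          unfolding ns using a b d C qx qq
          by (intro mult_right_mono frac_le mult_mono mult_pos_pos) (auto intro: less_imp_le)
        show "norm (s n) \<le> C / (b * d) * (norm q ^ (n choose 2) * norm (\<alpha> * q) ^ n)" for n
          unfolding ns using a b d C qx qq
          by (intro mult_right_mono frac_le mult_mono mult_pos_pos) (auto intro: less_imp_le)
        show "(\<lambda>(n, m). norm (s n * (F m * (\<tau> / q ^ n) ^ m))) summable_on UNIV"
          using D by (simp only: T_def)
      qed
      from abs_double_sum_rows[OF this]
      have S: "summable (\<lambda>n. \<Sum>m. s n * ((of_nat m - of_nat n) * F m * T n ^ m))"
        by (simp only: T_def)
      have "\<kappa> * (\<Sum>m. s n * ((of_nat m - of_nat n) * F m * T n ^ m)) = R n" for n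
      proof -
        have "qpoch_inf (v * (\<tau> / q ^ n)) q \<noteq> 0"
          using split[of v n] vT0[of n] V0 by (simp add: T_def V_def)
        note der = gen_hyp_coeff_derivative_at_zero[OF q Fsum[OF snz, unfolded F_def T_def]
            Psum[OF snz, unfolded T_def] i this, folded T_def F_def]
        have f: "(\<lambda>m. F m * T n ^ m) sums 0"
          using der(1) summable_norm_cancel[OF Fsum[OF snz]] by (simp add: sums_iff)
        define f' where "f' = (\<Sum>m. of_nat m * F m * T n ^ m)"
        have "(\<lambda>m. of_nat m * F m * T n ^ m) sums f'"
          unfolding f'_def by (rule summable_sums[OF der(2)])
        from sums_mult[OF sums_diff[OF this sums_mult[OF f, of "of_nat n"]], of "s n"]
        have eq: "(\<Sum>m. s n * ((of_nat m - of_nat n) * F m * T n ^ m)) = s n * f'"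
          by (simp add: sums_iff algebra_simps)
        have "u * T n * q ^ n = u * \<tau>" using q0 by (simp add: T_def)
        hence ui: "qpoch (u * T n) q (n + i) = qpoch (u * T n) q n * qpoch (u * \<tau>) q i"
          by (simp only: qpoch_add)
        \<comment> \<open>Simplicity of the zero: a second one at \<open>j < i\<close> would make a
          positive power of \<open>q\<close> equal to 1.\<close>
        have "qpoch (u * \<tau>) q i \<noteq> 0"
        proof
          assume "qpoch (u * \<tau>) q i = 0"
          then obtain j where j: "j < i" "u * \<tau> * q ^ j = 1" by (auto simp: qpoch_def)
          hence "q * q ^ (i - Suc j) = 1"
            using i by (metis Suc_diff_Suc mult_1 mult_cancel_left1 mult.assoc power_Suc power_add le_add_diff_inverse less_imp_le)
          thus False using mult_power_neq_1[OF q(2) q(2)] by blast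
        qed
        moreover have "f' * (qpoch (v * T n) q n * V) = - (qpoch (u * T n) q n * qpoch (u * \<tau>) q i * qpoch_inf q q * B n)"
          using der(3) by (simp only: f'_def split V_def ui B_def)
        moreover from this have "f' = - (qpoch (u * T n) q n * qpoch (u * \<tau>) q i * qpoch_inf q q * B n) / (qpoch (v * T n) q n * V)"
          using vT0[of n] V0 by (intro iffD2[OF eq_divide_eq]) simp
        ultimately show ?thesis
          using V0 qpoch_inf_nonzero[OF q(2) q(2)] unfolding eq R_eq \<kappa>_def by simp
      qed
      thus ?thesis using summable_mult[OF S, of \<kappa>] by simp
    qed
  qed
  have "K * U / V = qpochs_inf [q / x, u * x * t * q] q / qpochs_inf [\<alpha> * q, v * x * t * q] q"
    by (simp add: qpochs_inf_def K_def U_def V_def \<tau>_def mult_ac)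
  thus ?thesis
    using L R suminf_mult[OF R, of "K * U / V"] by (simp only: simp_thms)
qed

end
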